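(* Let $n\ge 2$ and let $H\in C^0(\mathbb R^n)$ be convex and coercive, and suppose that for every $c\in\mathbb R$ the level set $H^{-1}(c)$ does not contain any line segment. Then for every domain $\Omega\subset\mathbb R^n$, every absolute minimizer $u\in AM_H(\Omega)$ has the linear approximation property in $\Omega$, and for every $x\in\Omega$, $$H(e)=\lim_{r\to 0}\|H(Du)\|_{L^\infty(B_r(x))}\qquad\text{for all } e\in\mathscr D u(x).$$
   Context: $H$ is coercive if $\lim_{|p|\to\infty}H(p)=\infty$. A line segment is a set $[a,b]=\{\lambda a+(1-\lambda)b:\lambda\in[0,1]\}$ with $a\neq b$. For a domain $\Omega\subset\mathbb R^n$, a function $u\in W^{1,\infty}_{\rm loc}(\Omega)$ is an absolute minimizer for $H$ in $\Omega$, written $u\in AM_H(\Omega)$, if $\operatorname{ess\,sup}_{V}H(Du)\le \operatorname{ess\,sup}_{V}H(Dv)$ for every open $V\Subset\Omega$ and every $v\in W^{1,\infty}_{\rm loc}(V)\cap C(\overline V)$ with $v=u$ on $\partial V$. A function $u\in C^0(\Omega)$ has the linear approximation property if for every $x\in\Omega$ and every sequence of positive numbers $r_i\to0$ there exist a subsequence $(r_{i_k})$ and a vector $e\in\mathbb R^n$ such that $$\lim_{k\to\infty}\sup_{y\in B(0,1)}\Big|\frac{u(x+r_{i_k}y)-u(x)}{r_{i_k}}-e\cdot y\Big|=0.$$ $\mathscr D u(x)$ denotes the set of all vectors $e$ arising in this way at $x$ (over all sequences $r_i\to 0$).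
   Formalization: The L^∞ norm of H(Du) on B_r(x) is taken as the essential supremum of H(Du), without absolute value; with absolute values the identity fails when H is negative (H(p)=|p|^2-1, u=0), and for H≥0 the two agree. *)

theory Defs
  imports "HOL-Analysis.Analysis" "HOL-Probability.Essential_Supremum"
begin

section \<open>Test functions and weak gradients\<close>

primrec k_times_cont_diff :: "nat \<Rightarrow> ('a::euclidean_space \<Rightarrow> real) \<Rightarrow> bool" where
  "k_times_cont_diff 0 f \<longleftrightarrow> continuous_on UNIV f"
| "k_times_cont_diff (Suc k) f \<longleftrightarrow>
     (\<forall>x. f differentiable (at x)) \<and>
     (\<forall>i\<in>Basis. k_times_cont_diff k (\<lambda>x. frechet_derivative f (at x) i))"

definition test_function :: "'a::euclidean_space set \<Rightarrow> ('a \<Rightarrow> real) \<Rightarrow> bool" where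
  "test_function \<Omega> \<phi> \<longleftrightarrow>
     (\<forall>k. k_times_cont_diff k \<phi>) \<and>
     compact (closure {x. \<phi> x \<noteq> 0}) \<and> closure {x. \<phi> x \<noteq> 0} \<subseteq> \<Omega>"

definition locally_integrable_on ::
  "('a::euclidean_space \<Rightarrow> 'b::euclidean_space) \<Rightarrow> 'a set \<Rightarrow> bool" (infixr "locally'_integrable'_on" 46) where
  "f locally_integrable_on \<Omega> \<longleftrightarrow>
     (\<forall>K. compact K \<and> K \<subseteq> \<Omega> \<longrightarrow> f absolutely_integrable_on K)"

definition has_weak_gradient ::
  "'a::euclidean_space set \<Rightarrow> ('a \<Rightarrow> real) \<Rightarrow> ('a \<Rightarrow> 'a) \<Rightarrow> bool" where
  "has_weak_gradient \<Omega> u g \<longleftrightarrow>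
     u locally_integrable_on \<Omega> \<and> g locally_integrable_on \<Omega> \<and>
     (\<forall>\<phi>. test_function \<Omega> \<phi> \<longrightarrow> (\<forall>i\<in>Basis.
        (LINT x:\<Omega>|lebesgue. u x * frechet_derivative \<phi> (at x) i) =
        - (LINT x:\<Omega>|lebesgue. (g x \<bullet> i) * \<phi> x)))"

text \<open>On an open set a weak gradient is unique up to null sets, so the representative chosen
  here does not affect essential suprema. The value is only meaningful where a weak gradient exists.\<close>

definition weak_gradient :: "'a::euclidean_space set \<Rightarrow> ('a \<Rightarrow> real) \<Rightarrow> 'a \<Rightarrow> 'a" where
  "weak_gradient \<Omega> u = (SOME g. has_weak_gradient \<Omega> u g)"

definition Linf_loc ::
  "'a::euclidean_space set \<Rightarrow> ('a \<Rightarrow> 'b::euclidean_space) set" where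
  "Linf_loc \<Omega> = {f. f \<in> borel_measurable (lebesgue_on \<Omega>) \<and>
     (\<forall>K. compact K \<and> K \<subseteq> \<Omega> \<longrightarrow> (\<exists>C. AE x in lebesgue_on K. norm (f x) \<le> C))}"

definition W1inf_loc :: "'a::euclidean_space set \<Rightarrow> ('a \<Rightarrow> real) set" where
  "W1inf_loc \<Omega> = {u. u \<in> Linf_loc \<Omega> \<and>
     (\<exists>g. has_weak_gradient \<Omega> u g \<and> g \<in> Linf_loc \<Omega>)}"

section \<open>Absolute minimizers\<close>

text \<open>The essential supremum over \<open>V\<close> of \<open>H(Du)\<close>, where \<open>Du\<close> is the weak gradient of \<open>u\<close> on
  \<open>\<Omega>\<close>. It is extended-real-valued, since it may be infinite for functions in \<open>W1inf_loc V\<close>.\<close>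

definition esssup_H ::
  "('a::euclidean_space \<Rightarrow> real) \<Rightarrow> 'a set \<Rightarrow> ('a \<Rightarrow> real) \<Rightarrow> 'a set \<Rightarrow> ereal" where
  "esssup_H H \<Omega> u V = esssup (lebesgue_on V) (\<lambda>x. ereal (H (weak_gradient \<Omega> u x)))"

text \<open>Functions in \<open>W1inf_loc \<Omega>\<close> are actual functions rather than classes modulo null sets.
  The pointwise boundary condition below refers to the continuous representative, hence the
  requirement that \<open>u\<close> is continuous.\<close>

definition absolute_minimizers ::
  "('a::euclidean_space \<Rightarrow> real) \<Rightarrow> 'a set \<Rightarrow> ('a \<Rightarrow> real) set" where
  "absolute_minimizers H \<Omega> = {u. u \<in> W1inf_loc \<Omega> \<and> continuous_on \<Omega> u \<and>
     (\<forall>V v. open V \<and> compact (closure V) \<and> closure V \<subseteq> \<Omega> \<and>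
        v \<in> W1inf_loc V \<and> continuous_on (closure V) v \<and> (\<forall>x\<in>frontier V. v x = u x)
        \<longrightarrow> esssup_H H \<Omega> u V \<le> esssup_H H V v V)}"

section \<open>Linear approximation property\<close>

text \<open>If \<open>x\<close> lies in the open set \<open>\<Omega>\<close>, \<open>u\<close> is continuous on \<open>\<Omega>\<close> and \<open>r\<close> tends to 0, then for
  large \<open>k\<close> the points \<open>x + r k y\<close> range over a compact subset of \<open>\<Omega>\<close>; so the real
  supremum below is over a bounded set for all but finitely many \<open>k\<close>, and the limit does not
  depend on the values of \<open>u\<close> outside \<open>\<Omega>\<close>.\<close>

definition linear_blowup ::
  "('a::euclidean_space \<Rightarrow> real) \<Rightarrow> 'a \<Rightarrow> (nat \<Rightarrow> real) \<Rightarrow> 'a \<Rightarrow> bool" where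
  "linear_blowup u x r e \<longleftrightarrow>
     (\<lambda>k. SUP y\<in>ball 0 1. \<bar>(u (x + r k *\<^sub>R y) - u x) / r k - e \<bullet> y\<bar>) \<longlonglongrightarrow> 0"

definition linear_approximation_property ::
  "'a::euclidean_space set \<Rightarrow> ('a \<Rightarrow> real) \<Rightarrow> bool" where
  "linear_approximation_property \<Omega> u \<longleftrightarrow> continuous_on \<Omega> u \<and>
     (\<forall>x\<in>\<Omega>. \<forall>r::nat \<Rightarrow> real. (\<forall>i. r i > 0) \<and> r \<longlonglongrightarrow> 0 \<longrightarrow>
        (\<exists>s e. strict_mono s \<and> linear_blowup u x (r \<circ> s) e))"

definition blowup_slopes :: "('a::euclidean_space \<Rightarrow> real) \<Rightarrow> 'a \<Rightarrow> 'a set" where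
  "blowup_slopes u x = {e. \<exists>(r::nat \<Rightarrow> real) s. (\<forall>i. r i > 0) \<and> r \<longlonglongrightarrow> 0 \<and>
     strict_mono s \<and> linear_blowup u x (r \<circ> s) e}"

end

theory Submission
  imports Defs
begin

text \<open>For \<open>c \<ge> min H\<close> let \<open>K c = {p. H p \<le> c}\<close>, a compact convex set, and let \<open>C c\<close> be its
support function, called \<open>Hcone c\<close> below. Among the functions that vanish at the origin and
whose gradient satisfies \<open>H \<le> c\<close>, it is the largest one.

\<^item> The constraint \<open>H (Du) \<le> c\<close> almost everywhere on a convex open set means exactly
that \<open>u z - u y \<le> C c (z - y)\<close> for all \<open>y\<close>, \<open>z\<close> in it (\<open>increment_le_support_fun\<close> and
\<open>weak_gradient_mem_if_increments_le\<close>). This replaces every pointwise argument about the weak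
gradient by one about increments of a continuous function.

\<^item> Since no level set of \<open>H\<close> contains a segment, the linear functional given by
\<open>w \<noteq> 0\<close> has exactly one maximiser on \<open>K c\<close>. Hence \<open>C c\<close> is continuously differentiable
away from the origin, with that maximiser as its gradient, and a cone \<open>a + C c (y - x\<^sub>0)\<close>
is an admissible competitor on open sets avoiding its vertex. If \<open>u\<close> lies below the cone on the
boundary of such a set and above it somewhere inside, minimality gives \<open>H (Du) \<le> c\<close> on the
set where it is above; but along a ray from the vertex the cone already grows as fast as this
constraint permits, so \<open>u\<close> cannot have climbed above it (\<open>comparison_with_cones\<close>). The same
holds for cones from below.

\<^item> Let \<open>k\<close> be the limit of the essential suprema of \<open>H (Du)\<close> over the balls of radius \<open>r\<close>
around \<open>x\<close>, as \<open>r\<close> tends to 0; at small scales the increments of \<open>u\<close> are bounded by almost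
\<open>C k\<close>. If \<open>k > min H\<close>, comparison forces this bound to be attained: on every small sphere around
\<open>x\<close> there are points \<open>x + r a\<close> and \<open>x - r b\<close> with \<open>u (x + r a) - u x \<ge> r C k a\<close> and
\<open>u x - u (x - r b) \<ge> r C k b\<close>, because otherwise cones of a smaller level with vertices near
\<open>x\<close> would bound \<open>u\<close> and push the limit below \<open>k\<close> (\<open>touching_point\<close>).

\<^item> Adding the two inequalities gives \<open>C k a + C k b \<le> C k (a + b)\<close> up to a small
error, so the maximisers of \<open>a\<close> and \<open>b\<close> almost coincide; let \<open>p\<close> be that of \<open>a\<close>. Then \<open>H p = k\<close>.
Taking \<open>|a| = |b| = N\<close> large, the cones with vertices at the two far points look flat near \<open>x\<close>
with slope \<open>p\<close> and squeeze the difference quotient of \<open>u\<close> at scale \<open>r\<close> between linear functions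
close to \<open>p\<close>. This is \<open>nearly_linear_at_small_scales\<close>; when \<open>k = min H\<close> the set \<open>K k\<close> is a
single point and the bound on increments alone suffices.

Convergent subsequences of the slopes \<open>p\<close>, which stay in the compact set \<open>K k\<close>, give the linear
approximation property, and every blow-up slope is a limit of such \<open>p\<close>, hence lies on the level
\<open>k\<close>.\<close>

section \<open>Smooth bump functions\<close>

lemma k_times_cont_diff_SucD: "k_times_cont_diff (Suc k) f \<Longrightarrow> k_times_cont_diff k f"
proof (induction k arbitrary: f)
  case 0
  then show ?case
    by (auto simp: continuous_on_eq_continuous_at intro: differentiable_imp_continuous_within)
next
  case (Suc k)
  then show ?case by (metis k_times_cont_diff.simps(2))
qed

lemma k_times_cont_diff_SucI:
  assumes "\<And>x. (f has_derivative f' x) (at x)" "\<And>i. i \<in> Basis \<Longrightarrow> k_times_cont_diff k (\<lambda>x. f' x i)"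
  shows "k_times_cont_diff (Suc k) f"
proof -
  have "frechet_derivative f (at x) = f' x" for x
    using frechet_derivative_at[OF assms(1)] by simp
  then show ?thesis
    using assms by (auto simp: differentiable_def)
qed

lemma k_times_cont_diff_SucE:
  assumes "k_times_cont_diff (Suc k) f"
  shows "(f has_derivative frechet_derivative f (at x)) (at x)"
    "i \<in> Basis \<Longrightarrow> k_times_cont_diff k (\<lambda>x. frechet_derivative f (at x) i)"
  using assms by (auto simp: frechet_derivative_works)

lemma k_times_cont_diff_const: "k_times_cont_diff k (\<lambda>x. c)"
proof (induction k arbitrary: c)
  case (Suc k)
  show ?case
    by (rule k_times_cont_diff_SucI[where f'="\<lambda>x h. 0"]) (auto intro: Suc)
qed auto

lemma k_times_cont_diff_add:
  "k_times_cont_diff k f \<Longrightarrow> k_times_cont_diff k g \<Longrightarrow> k_times_cont_diff k (\<lambda>x. f x + g x)"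
proof (induction k arbitrary: f g)
  case 0
  then show ?case by (auto intro: continuous_intros)
next
  case (Suc k)
  show ?case
    by (rule k_times_cont_diff_SucI[OF has_derivative_add])
      (use Suc.prems in \<open>auto intro!: Suc.IH k_times_cont_diff_SucE simp del: k_times_cont_diff.simps\<close>)
qed

lemma k_times_cont_diff_mult:
  "k_times_cont_diff k f \<Longrightarrow> k_times_cont_diff k g \<Longrightarrow> k_times_cont_diff k (\<lambda>x. f x * g x)"
proof (induction k arbitrary: f g)
  case 0
  then show ?case by (auto intro: continuous_intros)
next
  case (Suc k)
  show ?case
    by (rule k_times_cont_diff_SucI[OF has_derivative_mult])
      (use Suc.prems in \<open>auto intro!: Suc.IH k_times_cont_diff_add k_times_cont_diff_SucE
         intro: k_times_cont_diff_SucD simp del: k_times_cont_diff.simps\<close>)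
qed

lemma k_times_cont_diff_diff:
  assumes "k_times_cont_diff k f" "k_times_cont_diff k g"
  shows "k_times_cont_diff k (\<lambda>x. f x - g x)"
  using k_times_cont_diff_add[OF assms(1) k_times_cont_diff_mult[OF k_times_cont_diff_const[of k "-1"] assms(2)]]
  by simp

lemma k_times_cont_diff_power:
  "k_times_cont_diff k f \<Longrightarrow> k_times_cont_diff k (\<lambda>x. f x ^ n)"
  by (induction n) (auto intro: k_times_cont_diff_const k_times_cont_diff_mult)

lemma k_times_cont_diff_prod:
  "(\<And>i. i \<in> I \<Longrightarrow> k_times_cont_diff k (f i)) \<Longrightarrow> k_times_cont_diff k (\<lambda>x. \<Prod>i\<in>I. f i x)"
  by (induction I rule: infinite_finite_induct)
    (auto intro: k_times_cont_diff_const k_times_cont_diff_mult)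

text \<open>The powers are carried along because the derivatives of \<open>exp (- 1 / t)\<close> are combinations of
these functions.\<close>

definition flat_exp :: "nat \<Rightarrow> real \<Rightarrow> real" where
  "flat_exp n t = (if t > 0 then exp (- inverse t) * inverse t ^ n else 0)"

lemma flat_exp_tendsto_0: "(flat_exp n \<longlongrightarrow> 0) (at 0)"
proof -
  have "(flat_exp n \<longlongrightarrow> 0) (at_left 0)"
    by (rule tendsto_eventually) (auto simp: flat_exp_def eventually_at intro!: exI[of _ 1])
  moreover have "(flat_exp n \<longlongrightarrow> 0) (at_right 0)"
  proof (rule Lim_transform_eventually)
    show "((\<lambda>t. inverse t ^ n / exp (inverse t)) \<longlongrightarrow> (0::real)) (at_right 0)"
      by (rule filterlim_compose[OF tendsto_power_div_exp_0 filterlim_inverse_at_top_right])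
    show "\<forall>\<^sub>F x in at_right 0. inverse x ^ n / exp (inverse x) = flat_exp n x"
      by (auto simp: flat_exp_def eventually_at exp_minus field_simps intro!: exI[of _ 1])
  qed
  ultimately show ?thesis
    by (simp add: filterlim_split_at)
qed

lemma flat_exp_has_real_derivative:
  "(flat_exp n has_real_derivative (flat_exp (n+2) t - real n * flat_exp (n+1) t)) (at t)"
proof -
  consider "t > 0" | "t < 0" | "t = 0" by linarith
  then show ?thesis
  proof cases
    case 1
    have pow: "((\<lambda>t. inverse t ^ n) has_real_derivative - real n * inverse t ^ (n+1)) (at t)"
    proof (cases n)
      case (Suc m)
      show ?thesis
        unfolding Suc by (rule DERIV_cong[OF DERIV_power_Suc[OF DERIV_inverse]])
          (use 1 in \<open>auto simp: algebra_simps power2_eq_square\<close>)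
    qed auto
    have ex: "((\<lambda>t. exp (- inverse t)) has_real_derivative exp (- inverse t) * (inverse t)\<^sup>2) (at t)"
      using 1 by (auto intro!: derivative_eq_intros simp: power2_eq_square)
    have "((\<lambda>t. exp (- inverse t) * inverse t ^ n) has_real_derivative
        (flat_exp (n+2) t - real n * flat_exp (n+1) t)) (at t)"
      by (rule DERIV_cong[OF DERIV_mult[OF ex pow]])
        (use 1 in \<open>simp add: flat_exp_def power2_eq_square algebra_simps\<close>)
    then show ?thesis
      by (rule has_field_derivative_transform_within_open[of _ _ _ "{0<..}"])
        (use 1 in \<open>auto simp: flat_exp_def\<close>)
  next
    case 2
    have "((\<lambda>t. 0) has_real_derivative (flat_exp (n+2) t - real n * flat_exp (n+1) t)) (at t)"
      using 2 by (auto simp: flat_exp_def)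
    then show ?thesis
      by (rule has_field_derivative_transform_within_open[of _ _ _ "{..<0}"])
        (use 2 in \<open>auto simp: flat_exp_def\<close>)
  next
    case 3
    have "((\<lambda>h. (flat_exp n (0 + h) - flat_exp n 0) / h) \<longlongrightarrow> 0) (at 0)"
      by (rule Lim_transform_eventually[OF flat_exp_tendsto_0[of "Suc n"]])
        (auto simp: flat_exp_def eventually_at field_simps intro!: exI[of _ 1])
    then show ?thesis
      using 3 by (simp add: DERIV_def) (simp add: flat_exp_def)
  qed
qed

text \<open>Differentiation turns \<open>flat_exp n\<close> into a combination of \<open>flat_exp (n + 1)\<close> and
\<open>flat_exp (n + 2)\<close>, so the induction on the order of differentiability has to treat all \<open>n\<close>
together.\<close>

lemma k_times_cont_diff_flat_exp:
  "k_times_cont_diff k (\<lambda>x::'a::euclidean_space. flat_exp n (c + x \<bullet> w))"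
proof (induction k arbitrary: n)
  case 0
  have "isCont (flat_exp n) t" for t
    using flat_exp_has_real_derivative DERIV_isCont by blast
  then have "continuous_on UNIV (flat_exp n)"
    by (auto simp: continuous_on_eq_continuous_at)
  then show ?case
    by (auto intro!: continuous_on_compose2[of UNIV "flat_exp n"] continuous_intros)
next
  case (Suc k)
  show ?case
  proof (rule k_times_cont_diff_SucI)
    fix x :: 'a
    show "((\<lambda>x. flat_exp n (c + x \<bullet> w)) has_derivative
       (\<lambda>h. (flat_exp (n+2) (c + x \<bullet> w) - real n * flat_exp (n+1) (c + x \<bullet> w)) * (h \<bullet> w))) (at x)"
      by (rule has_derivative_compose[of "\<lambda>x. c + x \<bullet> w" _ _ _ "flat_exp n",
            OF _ flat_exp_has_real_derivative[unfolded has_field_derivative_def]])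
        (auto intro!: derivative_eq_intros)
  qed (intro k_times_cont_diff_mult k_times_cont_diff_diff k_times_cont_diff_const Suc)
qed

text \<open>Each factor is flat across one face of the box, so the product is smooth and positive exactly in
the interior of the box.\<close>

definition bump :: "'a::euclidean_space \<Rightarrow> 'a \<Rightarrow> 'a \<Rightarrow> real" where
  "bump a b x = (\<Prod>i\<in>Basis. flat_exp 0 ((x - a) \<bullet> i) * flat_exp 0 ((b - x) \<bullet> i))"

lemma k_times_cont_diff_bump: "k_times_cont_diff k (bump a b)"
proof -
  have "k_times_cont_diff k (\<lambda>x. flat_exp 0 ((x - a) \<bullet> i) * flat_exp 0 ((b - x) \<bullet> i))" for i
    using k_times_cont_diff_mult[OF k_times_cont_diff_flat_exp[of k 0 "- (a \<bullet> i)" i]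
        k_times_cont_diff_flat_exp[of k 0 "b \<bullet> i" "- i"]]
    by (simp add: inner_diff_left algebra_simps)
  then show ?thesis
    unfolding bump_def[abs_def] by (intro k_times_cont_diff_prod)
qed

lemma bump_nonneg: "0 \<le> bump a b x"
  by (auto simp: bump_def flat_exp_def intro!: prod_nonneg)

lemma bump_le_1: "bump a b x \<le> 1"
proof -
  have "flat_exp 0 s \<le> 1" "0 \<le> flat_exp 0 s" for s by (auto simp: flat_exp_def)
  then show ?thesis
    unfolding bump_def by (intro prod_le_1) (auto intro: mult_le_one)
qed

lemma bump_pos: "x \<in> box a b \<Longrightarrow> 0 < bump a b x"
  by (auto simp: bump_def flat_exp_def box_def inner_diff_left intro!: prod_pos)

lemma bump_eq_0: "x \<notin> box a b \<Longrightarrow> bump a b x = 0"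
  by (auto simp: bump_def flat_exp_def box_def inner_diff_left)

lemma bump_translate: "bump (a + v) (b + v) x = bump a b (x - v)"
  by (simp add: bump_def algebra_simps)

lemma test_functionI:
  assumes "\<And>k. k_times_cont_diff k \<phi>" "\<And>x. x \<notin> cbox a b \<Longrightarrow> \<phi> x = 0" "cbox a b \<subseteq> \<Omega>"
  shows "test_function \<Omega> \<phi>"
proof -
  have "closure {x. \<phi> x \<noteq> 0} \<subseteq> cbox a b"
    by (rule closure_minimal) (use assms in auto)
  moreover from this have "compact (closure {x. \<phi> x \<noteq> 0})"
    by (simp add: compact_eq_bounded_closed bounded_subset[OF bounded_cbox])
  ultimately show ?thesis
    using assms unfolding test_function_def by blast
qed

lemma test_function_bump: "cbox a b \<subseteq> \<Omega> \<Longrightarrow> test_function \<Omega> (bump a b)"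
  by (rule test_functionI[OF k_times_cont_diff_bump])
    (use box_subset_cbox in \<open>auto intro!: bump_eq_0\<close>)

section \<open>Testing a weak gradient against translates\<close>

lemma borel_measurable_lebesgueI:
  "f \<in> borel_measurable borel \<Longrightarrow> f \<in> borel_measurable lebesgue"
  by (simp add: measurable_completion)

lemma continuous_borel_measurable_lebesgue:
  fixes f :: "'a::euclidean_space \<Rightarrow> 'b::euclidean_space"
  shows "continuous_on UNIV f \<Longrightarrow> f \<in> borel_measurable lebesgue"
  by (intro borel_measurable_lebesgueI borel_measurable_continuous_onI)

lemma integral_lebesgue_translate:
  fixes F :: "'a::euclidean_space \<Rightarrow> real"
  assumes [measurable]: "F \<in> borel_measurable borel"
  shows "(\<integral>w. F (w + v) \<partial>lebesgue) = (\<integral>w. F w \<partial>lebesgue)"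
proof -
  have "(\<integral>w. F (w + v) \<partial>lebesgue) = (\<integral>w. F (v + w) \<partial>lborel)"
    by (subst integral_completion) (auto simp: add.commute)
  also have "\<dots> = (\<integral>w. F w \<partial>distr lborel borel ((+) v))"
    by (subst integral_distr) auto
  also have "\<dots> = (\<integral>w. F w \<partial>lebesgue)"
    by (subst integral_completion) (auto simp: lborel_distr_plus)
  finally show ?thesis .
qed

lemma integrable_bounded_mult:
  fixes f \<psi> :: "'a::euclidean_space \<Rightarrow> real"
  assumes f: "integrable lebesgue f" and \<psi>: "\<psi> \<in> borel_measurable lebesgue"
    and B: "\<And>x. f x \<noteq> 0 \<Longrightarrow> \<bar>\<psi> x\<bar> \<le> B"
  shows "integrable lebesgue (\<lambda>x. f x * \<psi> x)"
proof (rule Bochner_Integration.integrable_bound[OF integrable_mult_right[OF f, of B]])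
  show "(\<lambda>x. f x * \<psi> x) \<in> borel_measurable lebesgue"
    using f \<psi> by auto
  have "\<bar>f x * \<psi> x\<bar> \<le> \<bar>B * f x\<bar>" for x
    using B[of x] by (cases "f x = 0") (auto simp: abs_mult mult.commute intro!: mult_right_mono)
  then show "AE x in lebesgue. norm (f x * \<psi> x) \<le> norm (B * f x)"
    by auto
qed

text \<open>Dominated convergence applies because the difference quotients of \<open>F\<close> in direction \<open>h\<close> are
bounded by \<open>B\<close>. Every integration by parts below is an instance, with \<open>F\<close> a test function or a
product with one.\<close>

lemma has_real_derivative_integral_translate:
  fixes f F D :: "'a::euclidean_space \<Rightarrow> real"
  assumes f: "integrable lebesgue f"
    and F: "\<And>x t. ((\<lambda>t. F (x + t *\<^sub>R h)) has_real_derivative D (x + t *\<^sub>R h)) (at t)"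
    and cF: "continuous_on UNIV F" and cD: "continuous_on UNIV D"
    and bF: "\<And>x. \<bar>F x\<bar> \<le> A" and bD: "\<And>x. \<bar>D x\<bar> \<le> B"
  shows "((\<lambda>t. \<integral>w. f w * F (w + t *\<^sub>R h) \<partial>lebesgue) has_real_derivative
           (\<integral>w. f w * D w \<partial>lebesgue)) (at 0)"
proof -
  have intF: "integrable lebesgue (\<lambda>w. f w * F (w + t *\<^sub>R h))" for t
    by (rule integrable_bounded_mult[OF f _ bF])
      (auto intro!: continuous_borel_measurable_lebesgue continuous_on_compose2[OF cF] continuous_intros)
  have lip: "\<bar>F (w + t *\<^sub>R h) - F w\<bar> \<le> B * \<bar>t\<bar>" for w t
    using field_differentiable_bound[of UNIV "\<lambda>t. F (w + t *\<^sub>R h)" "\<lambda>t. D (w + t *\<^sub>R h)" B t 0] F bD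
    by auto
  have "((\<lambda>t. ((\<integral>w. f w * F (w + (0 + t) *\<^sub>R h) \<partial>lebesgue) - (\<integral>w. f w * F (w + 0 *\<^sub>R h) \<partial>lebesgue)) / t)
      \<longlongrightarrow> (\<integral>w. f w * D w \<partial>lebesgue)) (at 0)"
    unfolding tendsto_at_iff_sequentially comp_def
  proof (intro allI impI)
    fix X :: "nat \<Rightarrow> real"
    assume X0: "\<forall>i. X i \<in> UNIV - {0}" and X: "X \<longlonglongrightarrow> 0"
    have "(\<lambda>i. \<integral>w. f w * ((F (w + X i *\<^sub>R h) - F w) / X i) \<partial>lebesgue)
        \<longlonglongrightarrow> (\<integral>w. f w * D w \<partial>lebesgue)"
    proof (rule integral_dominated_convergence[where w="\<lambda>w. B * \<bar>f w\<bar>"])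
      show "(\<lambda>w. f w * D w) \<in> borel_measurable lebesgue"
        by (intro borel_measurable_times borel_measurable_integrable[OF f]
          continuous_borel_measurable_lebesgue cD)
      show "(\<lambda>w. f w * ((F (w + X i *\<^sub>R h) - F w) / X i)) \<in> borel_measurable lebesgue" for i
        using X0 by (intro borel_measurable_times borel_measurable_integrable[OF f]
          continuous_borel_measurable_lebesgue continuous_intros continuous_on_compose2[OF cF]) auto
      show "integrable lebesgue (\<lambda>w. B * \<bar>f w\<bar>)"
        using f by auto
      have "(\<lambda>i. (F (w + X i *\<^sub>R h) - F w) / X i) \<longlonglongrightarrow> D w" for w
        using F[of w 0] X X0
        unfolding DERIV_def tendsto_at_iff_sequentially comp_def by auto
      then show "AE w in lebesgue. (\<lambda>i. f w * ((F (w + X i *\<^sub>R h) - F w) / X i)) \<longlonglongrightarrow> f w * D w"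
        by (intro always_eventually allI tendsto_mult tendsto_const)
      have "\<bar>f w * ((F (w + X i *\<^sub>R h) - F w) / X i)\<bar> \<le> B * \<bar>f w\<bar>" for i w
      proof -
        have "\<bar>(F (w + X i *\<^sub>R h) - F w) / X i\<bar> \<le> B"
          using lip[of w "X i"] X0[rule_format, of i] by (simp add: divide_le_eq abs_divide)
        then show ?thesis
          by (simp only: abs_mult mult.commute[of B] mult_left_mono abs_ge_zero)
      qed
      then show "AE w in lebesgue. norm (f w * ((F (w + X i *\<^sub>R h) - F w) / X i)) \<le> B * \<bar>f w\<bar>" for i
        by auto
    qed
    moreover have "(\<integral>w. f w * ((F (w + X i *\<^sub>R h) - F w) / X i) \<partial>lebesgue)
       = ((\<integral>w. f w * F (w + (0 + X i) *\<^sub>R h) \<partial>lebesgue) - (\<integral>w. f w * F (w + 0 *\<^sub>R h) \<partial>lebesgue)) / X i" for i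
      using intF[of "X i"] intF[of 0]
      by (simp add: right_diff_distrib diff_divide_distrib)
    ultimately show "(\<lambda>i. ((\<integral>w. f w * F (w + (0 + X i) *\<^sub>R h) \<partial>lebesgue) - (\<integral>w. f w * F (w + 0 *\<^sub>R h) \<partial>lebesgue)) / X i)
      \<longlonglongrightarrow> (\<integral>w. f w * D w \<partial>lebesgue)"
      by (simp only:)
  qed
  then show ?thesis
    by (simp add: DERIV_def)
qed

lemma test_function_derivative:
  assumes "test_function \<Omega> \<phi>"
  shows "(\<phi> has_derivative frechet_derivative \<phi> (at x)) (at x)"
    and "continuous_on UNIV (\<lambda>x. frechet_derivative \<phi> (at x) h)"
    and "continuous_on UNIV \<phi>"
    and "frechet_derivative \<phi> (at x) h = (\<Sum>i\<in>Basis. (h \<bullet> i) * frechet_derivative \<phi> (at x) i)"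
proof -
  have k: "k_times_cont_diff 0 \<phi>" "k_times_cont_diff (Suc 0) \<phi>"
    using assms unfolding test_function_def by blast+
  show der: "(\<phi> has_derivative frechet_derivative \<phi> (at x)) (at x)" for x
    by (rule k_times_cont_diff_SucE[OF k(2)])
  show lin: "frechet_derivative \<phi> (at x) h = (\<Sum>i\<in>Basis. (h \<bullet> i) * frechet_derivative \<phi> (at x) i)" for x h
  proof -
    interpret linear "frechet_derivative \<phi> (at x)"
      by (rule has_derivative_linear[OF der])
    have "frechet_derivative \<phi> (at x) (\<Sum>i\<in>Basis. (h \<bullet> i) *\<^sub>R i) =
        (\<Sum>i\<in>Basis. (h \<bullet> i) * frechet_derivative \<phi> (at x) i)"
      by (simp add: sum scale)
    then show ?thesis
      by (simp add: euclidean_representation)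
  qed
  have "continuous_on UNIV (\<lambda>x. frechet_derivative \<phi> (at x) i)" if "i \<in> Basis" for i
    using k_times_cont_diff_SucE(2)[OF k(2) that] by simp
  then show "continuous_on UNIV (\<lambda>x. frechet_derivative \<phi> (at x) h)"
    unfolding lin[of _ h] by (intro continuous_intros) auto
  show "continuous_on UNIV \<phi>"
    using k by simp
qed

lemma frechet_derivative_eq_0_outside:
  assumes "\<And>x. (\<phi> has_derivative frechet_derivative \<phi> (at x)) (at x)"
    and "closed S" "\<And>x. x \<notin> S \<Longrightarrow> \<phi> x = 0" "x \<notin> S"
  shows "frechet_derivative \<phi> (at x) h = (0::real)"
proof -
  have "(\<phi> has_derivative (\<lambda>_. 0)) (at x)"
    by (rule has_derivative_transform_within_open[of "\<lambda>_. 0" _ _ _ "- S"]) (use assms in auto)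
  from has_derivative_unique[OF assms(1) this] show ?thesis by simp
qed

lemma continuous_bounded_outside_compact:
  fixes \<psi> :: "'a::euclidean_space \<Rightarrow> real"
  assumes "continuous_on UNIV \<psi>" "compact S" "\<And>x. x \<notin> S \<Longrightarrow> \<psi> x = 0"
  obtains B where "\<And>x. \<bar>\<psi> x\<bar> \<le> B"
proof -
  have "bounded (\<psi> ` S)"
    using assms by (intro compact_imp_bounded compact_continuous_image) (auto intro: continuous_on_subset)
  then obtain B where "\<forall>x\<in>S. \<bar>\<psi> x\<bar> \<le> B"
    by (auto simp: bounded_iff)
  then have "\<bar>\<psi> x\<bar> \<le> max 0 B" for x
    using assms(3)[of x] by (cases "x \<in> S") (auto simp: le_max_iff_disj)
  then show ?thesis by (rule that)
qed

lemma locally_integrable_cutoff: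
  fixes f :: "'a::euclidean_space \<Rightarrow> real"
  assumes "f locally_integrable_on \<Omega>" "compact S" "S \<subseteq> \<Omega>"
  shows "integrable lebesgue (\<lambda>x. indicator S x * f x)"
  using assms by (auto simp: locally_integrable_on_def set_integrable_def)

lemma locally_integrable_inner:
  "g locally_integrable_on \<Omega> \<Longrightarrow> (\<lambda>x. g x \<bullet> h) locally_integrable_on \<Omega>"
  unfolding locally_integrable_on_def
  by (auto simp: set_integrable_def simp flip: inner_scaleR_left)

lemma LINT_cutoff:
  fixes f \<psi> :: "'a::euclidean_space \<Rightarrow> real"
  assumes "S \<subseteq> \<Omega>" "\<And>x. x \<notin> S \<Longrightarrow> \<psi> x = 0"
  shows "(LINT x:\<Omega>|lebesgue. f x * \<psi> x) = (\<integral>x. indicator S x * f x * \<psi> x \<partial>lebesgue)"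
  unfolding set_lebesgue_integral_def
  by (rule Bochner_Integration.integral_cong) (use assms in \<open>auto simp: indicator_def\<close>)

text \<open>Weak gradients are tested in coordinate directions; linearity of the derivative gives all
others. The indicator of \<open>S\<close> turns the locally integrable \<open>u\<close> and \<open>g\<close> into functions that are
integrable on the whole space.\<close>

lemma weak_gradient_direction:
  assumes w: "has_weak_gradient \<Omega> u g" and t: "test_function \<Omega> \<phi>"
    and S: "compact S" "S \<subseteq> \<Omega>" "\<And>x. x \<notin> S \<Longrightarrow> \<phi> x = 0"
  shows "(\<integral>x. indicator S x * u x * frechet_derivative \<phi> (at x) h \<partial>lebesgue) =
    - (\<integral>x. indicator S x * (g x \<bullet> h) * \<phi> x \<partial>lebesgue)"
proof -
  note d = test_function_derivative[OF t]
  have clS: "closed S" using S by (simp add: compact_imp_closed)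
  note z = frechet_derivative_eq_0_outside[OF d(1) clS S(3)]
  have iu: "integrable lebesgue (\<lambda>x. indicator S x * u x * frechet_derivative \<phi> (at x) i)" for i
  proof -
    obtain B where "\<And>x. \<bar>frechet_derivative \<phi> (at x) i\<bar> \<le> B"
      using continuous_bounded_outside_compact[OF d(2) S(1) z] by blast
    with w S show ?thesis
      by (intro integrable_bounded_mult locally_integrable_cutoff continuous_borel_measurable_lebesgue d(2))
        (auto simp: has_weak_gradient_def)
  qed
  have ig: "integrable lebesgue (\<lambda>x. indicator S x * (g x \<bullet> i) * \<phi> x)" for i
  proof -
    obtain B where "\<And>x. \<bar>\<phi> x\<bar> \<le> B"
      using continuous_bounded_outside_compact[OF d(3) S(1,3)] by blast
    with w S show ?thesis
      by (intro integrable_bounded_mult locally_integrable_cutoff continuous_borel_measurable_lebesgue d(3)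
          locally_integrable_inner) (auto simp: has_weak_gradient_def)
  qed
  have "(\<integral>x. indicator S x * u x * frechet_derivative \<phi> (at x) i \<partial>lebesgue) =
    - (\<integral>x. indicator S x * (g x \<bullet> i) * \<phi> x \<partial>lebesgue)" if i: "i \<in> Basis" for i
  proof -
    have "(LINT x:\<Omega>|lebesgue. u x * frechet_derivative \<phi> (at x) i) =
        - (LINT x:\<Omega>|lebesgue. (g x \<bullet> i) * \<phi> x)"
      using w t i by (simp add: has_weak_gradient_def)
    then show ?thesis
      using LINT_cutoff[OF S(2), of "\<lambda>x. frechet_derivative \<phi> (at x) i"] LINT_cutoff[OF S(2), of \<phi>] z S(3)
      by simp
  qed
  note eq = this
  have "(\<integral>x. indicator S x * u x * frechet_derivative \<phi> (at x) h \<partial>lebesgue) =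
     (\<integral>x. (\<Sum>i\<in>Basis. (h \<bullet> i) * (indicator S x * u x * frechet_derivative \<phi> (at x) i)) \<partial>lebesgue)"
    by (subst d(4)) (simp add: sum_distrib_left algebra_simps)
  also have "\<dots> = (\<Sum>i\<in>Basis. (h \<bullet> i) * - (\<integral>x. indicator S x * (g x \<bullet> i) * \<phi> x \<partial>lebesgue))"
    using iu eq by (subst Bochner_Integration.integral_sum) auto
  also have "\<dots> = - (\<integral>x. (\<Sum>i\<in>Basis. (h \<bullet> i) * (indicator S x * (g x \<bullet> i) * \<phi> x)) \<partial>lebesgue)"
    using ig by (subst Bochner_Integration.integral_sum) (auto simp: sum_negf)
  also have "(\<lambda>x. \<Sum>i\<in>Basis. (h \<bullet> i) * (indicator S x * (g x \<bullet> i) * \<phi> x)) =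
      (\<lambda>x. indicator S x * (g x \<bullet> h) * \<phi> x)"
  proof
    fix x
    have "g x \<bullet> h = (\<Sum>i\<in>Basis. (g x \<bullet> i) * (h \<bullet> i))"
      by (rule euclidean_inner)
    then show "(\<Sum>i\<in>Basis. (h \<bullet> i) * (indicator S x * (g x \<bullet> i) * \<phi> x)) = indicator S x * (g x \<bullet> h) * \<phi> x"
      by (cases "x \<in> S") (simp_all add: sum_distrib_left ac_simps)
  qed
  finally show ?thesis .
qed

text \<open>Translating the test function, rather than \<open>u\<close>, makes averages of \<open>u\<close> differentiable in the
translation.\<close>

lemma weak_gradient_translate_derivative:
  assumes w: "has_weak_gradient \<Omega> u g" and t: "test_function \<Omega> \<phi>"
    and S: "compact S" "S \<subseteq> \<Omega>" "\<And>x. x \<notin> S \<Longrightarrow> \<phi> x = 0"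
  shows "((\<lambda>t. \<integral>x. indicator S x * u x * \<phi> (x + t *\<^sub>R h) \<partial>lebesgue) has_real_derivative
     - (\<integral>x. indicator S x * (g x \<bullet> h) * \<phi> x \<partial>lebesgue)) (at 0)"
proof -
  note d = test_function_derivative[OF t]
  note z = frechet_derivative_eq_0_outside[OF d(1) compact_imp_closed[OF S(1)] S(3)]
  obtain B where B: "\<And>x. \<bar>frechet_derivative \<phi> (at x) h\<bar> \<le> B"
    using continuous_bounded_outside_compact[OF d(2) S(1) z] by blast
  obtain A where A: "\<And>x. \<bar>\<phi> x\<bar> \<le> A"
    using continuous_bounded_outside_compact[OF d(3) S(1,3)] by blast
  have "((\<lambda>t. \<phi> (x + t *\<^sub>R h)) has_real_derivative frechet_derivative \<phi> (at (x + t *\<^sub>R h)) h) (at t)" for x t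
  proof -
    interpret linear "frechet_derivative \<phi> (at (x + t *\<^sub>R h))"
      by (rule has_derivative_linear[OF d(1)])
    have "((\<lambda>t. \<phi> (x + t *\<^sub>R h)) has_derivative (\<lambda>s. frechet_derivative \<phi> (at (x + t *\<^sub>R h)) (s *\<^sub>R h))) (at t)"
      by (rule has_derivative_compose[OF _ d(1)]) (auto intro!: derivative_eq_intros)
    then show ?thesis
      by (simp add: has_field_derivative_def scale mult.commute[of _ "frechet_derivative _ _ _"])
  qed
  moreover have "integrable lebesgue (\<lambda>x. indicator S x * u x)"
    using w S by (intro locally_integrable_cutoff) (auto simp: has_weak_gradient_def)
  ultimately have "((\<lambda>t. \<integral>x. indicator S x * u x * \<phi> (x + t *\<^sub>R h) \<partial>lebesgue) has_real_derivative
     (\<integral>x. indicator S x * u x * frechet_derivative \<phi> (at x) h \<partial>lebesgue)) (at 0)"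
    by (intro has_real_derivative_integral_translate[OF _ _ d(3) d(2) A B])
  then show ?thesis
    using weak_gradient_direction[OF w t S(1,2), of h] S(3) by simp
qed

section \<open>Support functions\<close>

definition support_fun :: "'a::euclidean_space set \<Rightarrow> 'a \<Rightarrow> real" where
  "support_fun K w = (SUP p\<in>K. p \<bullet> w)"

lemma support_fun_attained:
  assumes "compact K" "K \<noteq> {}"
  obtains p where "p \<in> K" "support_fun K w = p \<bullet> w"
proof -
  have "continuous_on K (\<lambda>p. p \<bullet> w)" by (intro continuous_intros)
  from continuous_attains_sup[OF assms this]
  obtain p where "p \<in> K" "\<forall>q\<in>K. q \<bullet> w \<le> p \<bullet> w" by blast
  then have "support_fun K w = p \<bullet> w"
    unfolding support_fun_def by (intro cSup_eq_maximum) auto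
  with \<open>p \<in> K\<close> show ?thesis by (rule that)
qed

lemma support_fun_ge:
  assumes "compact K" "p \<in> K"
  shows "p \<bullet> w \<le> support_fun K w"
proof -
  have "compact ((\<lambda>p. p \<bullet> w) ` K)"
    using assms by (intro compact_continuous_image continuous_intros)
  then show ?thesis
    unfolding support_fun_def using assms by (intro cSUP_upper bounded_imp_bdd_above compact_imp_bounded)
qed

lemma support_fun_le:
  assumes "compact K" "K \<noteq> {}" "\<And>p. p \<in> K \<Longrightarrow> p \<bullet> w \<le> c"
  shows "support_fun K w \<le> c"
  unfolding support_fun_def using assms by (intro cSUP_least)

lemma support_fun_scale:
  assumes "compact K" "K \<noteq> {}" "0 \<le> t"
  shows "support_fun K (t *\<^sub>R w) = t * support_fun K w"
proof (rule antisym)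
  show "support_fun K (t *\<^sub>R w) \<le> t * support_fun K w"
    using assms by (intro support_fun_le) (auto intro!: mult_left_mono support_fun_ge)
  obtain p where "p \<in> K" "support_fun K w = p \<bullet> w"
    by (rule support_fun_attained[OF assms(1,2)])
  then show "t * support_fun K w \<le> support_fun K (t *\<^sub>R w)"
    using support_fun_ge[OF assms(1), of p "t *\<^sub>R w"] by simp
qed

lemma support_fun_diff_le:
  assumes "compact K" "K \<noteq> {}"
  shows "support_fun K v - support_fun K w \<le> support_fun K (v - w)"
proof -
  obtain p where "p \<in> K" "support_fun K v = p \<bullet> v"
    by (rule support_fun_attained[OF assms])
  then show ?thesis
    using support_fun_ge[OF assms(1), of p w] support_fun_ge[OF assms(1), of p "v - w"]
    by (simp add: inner_diff_right)
qed

lemma support_fun_bound: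
  assumes "compact K" "K \<noteq> {}" "K \<subseteq> cball 0 R"
  shows "\<bar>support_fun K w\<bar> \<le> R * norm w"
proof -
  obtain p where p: "p \<in> K" "support_fun K w = p \<bullet> w"
    by (rule support_fun_attained[OF assms(1,2)])
  have "\<bar>p \<bullet> w\<bar> \<le> norm p * norm w" by (rule Cauchy_Schwarz_ineq2)
  also have "\<dots> \<le> R * norm w" using p assms(3) by (auto intro!: mult_right_mono)
  finally show ?thesis using p by simp
qed

lemma support_fun_lipschitz:
  assumes "compact K" "K \<noteq> {}" "K \<subseteq> cball 0 R"
  shows "\<bar>support_fun K v - support_fun K w\<bar> \<le> R * norm (v - w)"
  using support_fun_diff_le[OF assms(1,2), of v w] support_fun_diff_le[OF assms(1,2), of w v]
    support_fun_bound[OF assms, of "v - w"] support_fun_bound[OF assms, of "w - v"]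
  by (auto simp: norm_minus_commute)

lemma compact_subset_cball:
  fixes K :: "'a::euclidean_space set"
  assumes "compact K" obtains R where "0 < R" "K \<subseteq> cball 0 R"
proof -
  obtain b where "0 < b" "\<forall>x\<in>K. norm x \<le> b"
    using compact_imp_bounded[OF assms] unfolding bounded_pos by blast
  then show ?thesis by (intro that[of b]) auto
qed

lemma support_fun_continuous:
  assumes "compact K" "K \<noteq> {}"
  shows "continuous_on S (support_fun K)"
proof -
  obtain R where R: "0 < R" "K \<subseteq> cball 0 R" by (rule compact_subset_cball[OF assms(1)])
  have "R-lipschitz_on S (support_fun K)"
    using support_fun_lipschitz[OF assms R(2)] R(1)
    by (intro lipschitz_onI) (auto simp: dist_real_def dist_norm)
  then show ?thesis by (rule lipschitz_on_continuous_on)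
qed

text \<open>A separating hyperplane would violate the inequality in its normal direction. A dense set of
directions is enough by continuity, so a membership that holds almost everywhere follows from
countably many inequalities.\<close>

lemma mem_if_inner_le_support_fun:
  assumes K: "compact K" "convex K" "K \<noteq> {}"
    and D: "closure D = UNIV" "\<And>h. h \<in> D \<Longrightarrow> p \<bullet> h \<le> support_fun K h"
  shows "p \<in> K"
proof (rule ccontr)
  assume "p \<notin> K"
  then obtain a b where ab: "a \<bullet> p < b" "\<forall>x\<in>K. a \<bullet> x > b"
    using separating_hyperplane_closed_point[of K p] K by (auto simp: compact_imp_closed)
  have "UNIV \<subseteq> {h. p \<bullet> h \<le> support_fun K h}"
    unfolding D(1)[symmetric]
    by (rule closure_minimal) (use D K in \<open>auto intro!: closed_Collect_le support_fun_continuous continuous_intros\<close>)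
  then have "- a \<in> {h. p \<bullet> h \<le> support_fun K h}" by (rule subsetD) simp
  then have "p \<bullet> (- a) \<le> support_fun K (- a)" by simp
  moreover have "support_fun K (- a) \<le> - b"
    using K ab by (intro support_fun_le) (auto simp: inner_commute less_imp_le)
  ultimately show False using ab by (simp add: inner_commute)
qed

section \<open>Gradient constraints and increments\<close>

lemma compact_neighbourhood_in_open:
  fixes A :: "'a::euclidean_space set"
  assumes "compact A" "open W" "A \<subseteq> W" "A \<noteq> {}"
  obtains S d where "compact S" "S \<subseteq> W" "0 < d" "\<And>x y. x \<in> A \<Longrightarrow> dist x y \<le> d \<Longrightarrow> y \<in> S"
proof -
  obtain e where e: "e > 0" "(\<Union>x\<in>A. ball x e) \<subseteq> W"
    by (rule compact_subset_open_imp_ball_epsilon_subset[OF assms(1-3)]) auto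
  let ?S = "{x. infdist x A \<le> e / 2}"
  show thesis
  proof (rule that)
    show "compact ?S" using assms e by (intro compact_infdist_le) auto
    show "?S \<subseteq> W"
    proof
      fix y assume y: "y \<in> ?S"
      obtain x where "x \<in> A" "infdist y A = dist y x"
        using infdist_attains_inf[of A y] assms by (auto simp: compact_imp_closed)
      with y e(1) have "y \<in> ball x e" by (auto simp: dist_commute)
      with e(2) \<open>x \<in> A\<close> show "y \<in> W" by blast
    qed
    show "0 < e / 2" using e by simp
    show "y \<in> ?S" if "x \<in> A" "dist x y \<le> e / 2" for x y
      using infdist_le[of x A y] that by (auto simp: dist_commute)
  qed
qed

lemma integrable_test_function:
  assumes t: "test_function \<Omega> \<phi>" and S: "compact S" "\<And>x. x \<notin> S \<Longrightarrow> \<phi> x = 0"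
  shows "integrable lebesgue \<phi>"
proof -
  obtain B where B: "\<And>x. \<bar>\<phi> x\<bar> \<le> B"
    using continuous_bounded_outside_compact[OF test_function_derivative(3)[OF t] S] by blast
  have "integrable lebesgue (\<lambda>x. indicator S x * \<phi> x)"
    using S B t
    by (intro integrable_bounded_mult continuous_borel_measurable_lebesgue test_function_derivative(3)[OF t])
      (auto simp flip: lmeasurable_iff_integrable intro: lmeasurable_compact)
  then show ?thesis
    by (rule Bochner_Integration.integrable_cong[THEN iffD1, rotated 2]) (use S in \<open>auto simp: indicator_def\<close>)
qed

text \<open>This bounds the derivative of a moving average of \<open>u\<close> in terms of a pointwise constraint on the
gradient.\<close>

lemma cutoff_inner_bound:
  assumes w: "has_weak_gradient \<Omega> u g" and t: "test_function \<Omega> \<phi>"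
    and S: "compact S" "S \<subseteq> \<Omega>" "\<And>x. x \<notin> S \<Longrightarrow> \<phi> x = 0"
    and nn: "\<And>x. 0 \<le> \<phi> x" and c: "AE x in lebesgue. x \<in> S \<longrightarrow> g x \<bullet> h \<le> c"
  shows "(\<integral>x. indicator S x * (g x \<bullet> h) * \<phi> x \<partial>lebesgue) \<le> c * (\<integral>x. \<phi> x \<partial>lebesgue)"
proof -
  note i = integrable_test_function[OF t S(1,3)]
  obtain B where B: "\<And>x. \<bar>\<phi> x\<bar> \<le> B"
    using continuous_bounded_outside_compact[OF test_function_derivative(3)[OF t] S(1,3)] by blast
  have "integrable lebesgue (\<lambda>x. indicator S x * (g x \<bullet> h) * \<phi> x)"
    using w S by (intro integrable_bounded_mult[OF _ _ B] locally_integrable_cutoff locally_integrable_inner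
       continuous_borel_measurable_lebesgue test_function_derivative(3)[OF t]) (auto simp: has_weak_gradient_def)
  moreover have "AE x in lebesgue. indicator S x * (g x \<bullet> h) * \<phi> x \<le> c * \<phi> x"
    using c
  proof eventually_elim
    case (elim x)
    then show ?case
      using S(3)[of x] nn[of x] by (cases "x \<in> S") (auto intro: mult_right_mono)
  qed
  ultimately have "(\<integral>x. indicator S x * (g x \<bullet> h) * \<phi> x \<partial>lebesgue) \<le> (\<integral>x. c * \<phi> x \<partial>lebesgue)"
    using i by (intro integral_mono_AE) auto
  then show ?thesis by simp
qed

lemma integral_bump_pos:
  fixes a b :: "'a::euclidean_space"
  assumes "box a b \<noteq> {}"
  shows "0 < (\<integral>x. bump a b x \<partial>lebesgue)"
proof -
  have t: "test_function UNIV (bump a b)" by (rule test_function_bump) simp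
  have i: "integrable lebesgue (bump a b)"
    by (rule integrable_test_function[OF t compact_cbox[of a b]])
      (use box_subset_cbox in \<open>auto intro!: bump_eq_0\<close>)
  have "(\<integral>x. bump a b x \<partial>lebesgue) \<noteq> 0"
  proof
    assume "(\<integral>x. bump a b x \<partial>lebesgue) = 0"
    then have "AE x in lebesgue. bump a b x = 0"
      using integral_nonneg_eq_0_iff_AE[OF i] by (simp add: bump_nonneg)
    then have "AE x in lebesgue. x \<notin> box a b"
      by eventually_elim (metis bump_pos less_irrefl)
    then have "negligible (box a b)"
      by (simp add: AE_iff_null_sets negligible_iff_null_sets)
    with assms show False
      using negligible_interval(2) by blast
  qed
  moreover have "0 \<le> (\<integral>x. bump a b x \<partial>lebesgue)"
    by (simp add: bump_nonneg)
  ultimately show ?thesis by simp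
qed

lemma dist_box_centre:
  fixes c w :: "'a::euclidean_space"
  assumes "w \<in> cbox (c - r *\<^sub>R One) (c + r *\<^sub>R One)"
  shows "dist c w \<le> real DIM('a) * r"
proof -
  have "norm (w - c) \<le> (\<Sum>i\<in>Basis. \<bar>(w - c) \<bullet> i\<bar>)" by (rule norm_le_l1)
  also have "\<dots> \<le> (\<Sum>i\<in>(Basis::'a set). r)"
    using assms by (intro sum_mono) (auto simp: cbox_def inner_diff_left inner_add_left abs_le_iff)
  finally show ?thesis by (simp add: dist_norm norm_minus_commute)
qed

text \<open>Average \<open>u\<close> against a bump whose centre moves from \<open>x\<close> to \<open>y\<close> at constant speed. The derivative
of this average is the average of \<open>g z \<bullet> (y - x)\<close>, which the constraint bounds by the
support function; as the bump shrinks, the averages at the two ends approach \<open>u x\<close> and \<open>u y\<close>.\<close>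

lemma increment_le_support_fun:
  fixes u :: "'a::euclidean_space \<Rightarrow> real"
  assumes w: "has_weak_gradient \<Omega> u g" and W: "open W" "W \<subseteq> \<Omega>" and u: "continuous_on W u"
    and g: "AE z in lebesgue. z \<in> W \<longrightarrow> g z \<in> K" and K: "compact K" "K \<noteq> {}"
    and seg: "closed_segment x y \<subseteq> W"
  shows "u y - u x \<le> support_fun K (y - x)"
proof (rule field_le_epsilon)
  fix e :: real assume e: "0 < e"
  obtain S d where S: "compact S" "S \<subseteq> W" "0 < d"
    "\<And>x' y'. x' \<in> closed_segment x y \<Longrightarrow> dist x' y' \<le> d \<Longrightarrow> y' \<in> S"
    by (rule compact_neighbourhood_in_open[OF compact_segment W(1) seg]) auto
  have "continuous (at z) u" if "z \<in> W" for z
    using u W(1) that continuous_on_eq_continuous_at by blast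
  then have near: "\<exists>d'>0. \<forall>w. dist w z < d' \<longrightarrow> dist (u w) (u z) < e / 2" if "z \<in> W" for z
    using that e unfolding continuous_at_eps_delta by (meson half_gt_zero)
  obtain d1 where d1: "0 < d1" "\<And>w. dist w x < d1 \<Longrightarrow> dist (u w) (u x) < e / 2"
    using near[of x] seg by auto
  obtain d2 where d2: "0 < d2" "\<And>w. dist w y < d2 \<Longrightarrow> dist (u w) (u y) < e / 2"
    using near[of y] seg by auto
  \<comment> \<open>half the side of the bump; a point of the cube is within DIM('a) * r of its centre\<close>
  define r where "r = min d (min (d1/2) (d2/2)) / DIM('a)"
  have r: "0 < r" using S(3) d1(1) d2(1) by (simp add: r_def)
  have rle: "dist c w \<le> d" "dist c w < d1" "dist c w < d2" if "w \<in> cbox (c - r *\<^sub>R One) (c + r *\<^sub>R One)" for c w :: 'a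
    using dist_box_centre[OF that] d1(1) d2(1) by (auto simp: r_def)
  define h where "h = y - x"
  define c where "c t = x + t *\<^sub>R h" for t
  define \<phi> where "\<phi> t = bump (c t - r *\<^sub>R One) (c t + r *\<^sub>R One)" for t
  define I where "I = (\<integral>z. \<phi> 0 z \<partial>lebesgue)"
  define \<Phi> where "\<Phi> t = (\<integral>z. indicator S z * u z * \<phi> t z \<partial>lebesgue)" for t
  have shift: "\<phi> (t + s) z = \<phi> t (z + s *\<^sub>R (- h))" for t s z
    using bump_translate[of "c t - r *\<^sub>R One" "s *\<^sub>R h" "c t + r *\<^sub>R One" z]
    by (simp add: \<phi>_def c_def algebra_simps)
  have cseg: "c t \<in> closed_segment x y" if "0 \<le> t" "t \<le> 1" for t
    using that by (auto simp: closed_segment_def c_def h_def algebra_simps intro!: exI[of _ t])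
  have box_S: "cbox (c t - r *\<^sub>R One) (c t + r *\<^sub>R One) \<subseteq> S" if "0 \<le> t" "t \<le> 1" for t
    using S(4)[OF cseg[OF that]] rle(1) by blast
  have test: "test_function \<Omega> (\<phi> t)" if "0 \<le> t" "t \<le> 1" for t
    unfolding \<phi>_def using box_S[OF that] S(2) W(2) by (intro test_function_bump) auto
  have zero: "\<phi> t z = 0" if "z \<notin> cbox (c t - r *\<^sub>R One) (c t + r *\<^sub>R One)" for t z
    unfolding \<phi>_def using that box_subset_cbox by (intro bump_eq_0) auto
  have zeroS: "\<phi> t z = 0" if "0 \<le> t" "t \<le> 1" "z \<notin> S" for t z
    using zero box_S that by blast
  have I: "(\<integral>z. \<phi> t z \<partial>lebesgue) = I" for t
  proof -
    have "\<phi> 0 \<in> borel_measurable borel"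
      unfolding \<phi>_def using k_times_cont_diff_bump[of 0] by (auto intro: borel_measurable_continuous_onI)
    from integral_lebesgue_translate[OF this, of "t *\<^sub>R (- h)"] show ?thesis
      using shift[of 0 t] by (simp add: I_def)
  qed
  have Ipos: "0 < I"
  proof -
    have "c 0 \<in> box (c 0 - r *\<^sub>R One) (c 0 + r *\<^sub>R One)"
      using r by (auto simp: box_def inner_diff_left inner_add_left)
    then show ?thesis
      unfolding I_def \<phi>_def by (intro integral_bump_pos) auto
  qed
  have intphi: "integrable lebesgue (\<phi> t)" if "0 \<le> t" "t \<le> 1" for t
    using integrable_test_function[OF test[OF that] S(1)] zeroS[OF that] by blast
  have S\<Omega>: "S \<subseteq> \<Omega>" using S(2) W(2) by auto
  define \<Phi>' where "\<Phi>' t = (\<integral>z. indicator S z * (g z \<bullet> h) * \<phi> t z \<partial>lebesgue)" for t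
  have der: "(\<Phi> has_real_derivative \<Phi>' t) (at t)" if "0 \<le> t" "t \<le> 1" for t
  proof -
    have "((\<lambda>s. \<integral>z. indicator S z * u z * \<phi> t (z + s *\<^sub>R (- h)) \<partial>lebesgue) has_real_derivative
        - (\<integral>z. indicator S z * (g z \<bullet> (- h)) * \<phi> t z \<partial>lebesgue)) (at 0)"
      by (rule weak_gradient_translate_derivative[OF w test[OF that] S(1) S\<Omega>]) (rule zeroS[OF that])
    then have "((\<lambda>s. \<Phi> (t + s)) has_real_derivative \<Phi>' t) (at 0)"
      by (simp add: \<Phi>_def \<Phi>'_def shift)
    then show ?thesis
      using DERIV_shift[of \<Phi> "\<Phi>' t" 0 t] by (simp add: add.commute)
  qed
  have der_le: "\<Phi>' t \<le> support_fun K h * I" if "0 \<le> t" "t \<le> 1" for t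
  proof -
    have "AE z in lebesgue. z \<in> S \<longrightarrow> g z \<bullet> h \<le> support_fun K h"
      using g by eventually_elim (use S(2) support_fun_ge[OF K(1)] in auto)
    moreover have "0 \<le> \<phi> t z" for z by (simp add: \<phi>_def bump_nonneg)
    ultimately show ?thesis
      using cutoff_inner_bound[OF w test[OF that] S(1) S\<Omega>] zeroS[OF that] I[of t]
      by (simp add: \<Phi>'_def)
  qed
  obtain t where t: "0 < t" "t < 1" "\<Phi> 1 - \<Phi> 0 = (1 - 0) * \<Phi>' t"
    using MVT2[of 0 1 \<Phi> \<Phi>'] der by auto
  then have up: "\<Phi> 1 - \<Phi> 0 \<le> support_fun K h * I"
    using der_le[of t] by simp
  \<comment> \<open>only used at the end points, where the oscillation of u on the cube is below e / 2\<close>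
  have avg: "\<bar>\<Phi> t - u (c t) * I\<bar> \<le> e / 2 * I" if t: "0 \<le> t" "t \<le> 1"
    and cl: "\<And>z. z \<in> cbox (c t - r *\<^sub>R One) (c t + r *\<^sub>R One) \<Longrightarrow> dist (u z) (u (c t)) < e / 2" for t
  proof -
    obtain B where B: "\<And>z. \<bar>\<phi> t z\<bar> \<le> B"
      using continuous_bounded_outside_compact[OF test_function_derivative(3)[OF test[OF t]] S(1)] zeroS[OF t] by blast
    have i1: "integrable lebesgue (\<lambda>z. indicator S z * u z * \<phi> t z)"
      using w S(1) S\<Omega> by (intro integrable_bounded_mult[OF _ _ B] locally_integrable_cutoff
          continuous_borel_measurable_lebesgue test_function_derivative(3)[OF test[OF t]])
        (auto simp: has_weak_gradient_def)
    have i2: "integrable lebesgue (\<lambda>z. u (c t) * \<phi> t z)"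
      using intphi[OF t] by simp
    have "\<Phi> t - u (c t) * I = (\<integral>z. indicator S z * u z * \<phi> t z - u (c t) * \<phi> t z \<partial>lebesgue)"
      unfolding \<Phi>_def using i1 i2 I[of t] by simp
    also have "\<bar>\<dots>\<bar> \<le> (\<integral>z. \<bar>indicator S z * u z * \<phi> t z - u (c t) * \<phi> t z\<bar> \<partial>lebesgue)"
      by (rule integral_abs_bound)
    also have "\<dots> \<le> (\<integral>z. e / 2 * \<phi> t z \<partial>lebesgue)"
    proof (rule integral_mono)
      fix z
      show "\<bar>indicator S z * u z * \<phi> t z - u (c t) * \<phi> t z\<bar> \<le> e / 2 * \<phi> t z"
      proof (cases "z \<in> cbox (c t - r *\<^sub>R One) (c t + r *\<^sub>R One)")
        case True
        then have "\<bar>indicator S z * u z * \<phi> t z - u (c t) * \<phi> t z\<bar> = \<bar>u z - u (c t)\<bar> * \<phi> t z"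
          using box_S[OF t] by (auto simp: abs_mult \<phi>_def bump_nonneg simp flip: left_diff_distrib)
        also have "\<dots> \<le> e / 2 * \<phi> t z"
          using cl[OF True] by (intro mult_right_mono) (auto simp: dist_real_def \<phi>_def bump_nonneg)
        finally show ?thesis .
      qed (simp add: zero)
    qed (use i1 i2 intphi[OF t] in auto)
    finally show ?thesis by (simp add: I)
  qed
  have "\<bar>\<Phi> 0 - u x * I\<bar> \<le> e / 2 * I"
    using avg[of 0] d1(2) rle(2) by (simp add: c_def dist_commute)
  moreover have "\<bar>\<Phi> 1 - u y * I\<bar> \<le> e / 2 * I"
    using avg[of 1] d2(2) rle(3) by (simp add: c_def h_def dist_commute)
  ultimately have "u y * I - \<Phi> 1 \<le> e / 2 * I" "\<Phi> 0 - u x * I \<le> e / 2 * I"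
    by linarith+
  then have "(u y - u x) * I \<le> (support_fun K (y - x) + e) * I"
    using up by (simp add: algebra_simps h_def)
  then show "u y - u x \<le> support_fun K (y - x) + e"
    using Ipos by (simp add: mult_le_cancel_right)
qed

text \<open>By translation invariance a shift of the test function is a shift of \<open>u\<close> in the opposite
direction, so the difference quotient of the average is controlled by the hypothesis on
increments before passing to the limit.\<close>

lemma weak_gradient_tested_le:
  assumes w: "has_weak_gradient \<Omega> u g" and W: "open W" "W \<subseteq> \<Omega>" and u: "continuous_on W u"
    and inc: "\<And>y z. y \<in> W \<Longrightarrow> z \<in> W \<Longrightarrow> u z - u y \<le> support_fun K (z - y)"
    and K: "compact K" "K \<noteq> {}"
    and A: "compact A" "A \<subseteq> W" and t: "test_function \<Omega> \<phi>"
    and \<phi>: "\<And>x. x \<notin> A \<Longrightarrow> \<phi> x = 0" "\<And>x. 0 \<le> \<phi> x"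
  shows "(\<integral>x. indicator A x * (g x \<bullet> h) * \<phi> x \<partial>lebesgue) \<le> support_fun K h * (\<integral>x. \<phi> x \<partial>lebesgue)"
proof (cases "A = {}")
  case True
  then have "\<phi> = (\<lambda>x. 0)" using \<phi> by auto
  then show ?thesis by simp
next
  case False
  obtain S d where S: "compact S" "S \<subseteq> W" "0 < d"
    "\<And>x y. x \<in> A \<Longrightarrow> dist x y \<le> d \<Longrightarrow> y \<in> S"
    by (rule compact_neighbourhood_in_open[OF A(1) W(1) A(2) False]) auto
  have AS: "A \<subseteq> S" using S(3,4) by force
  have zS: "\<phi> x = 0" if "x \<notin> S" for x using \<phi>(1) AS that by auto
  have S\<Omega>: "S \<subseteq> \<Omega>" using S(2) W(2) by auto
  define I where "I = (\<integral>x. \<phi> x \<partial>lebesgue)"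
  define G where "G = (\<integral>x. indicator S x * (g x \<bullet> h) * \<phi> x \<partial>lebesgue)"
  define \<Psi> where "\<Psi> t = (\<integral>x. indicator S x * u x * \<phi> (x + t *\<^sub>R h) \<partial>lebesgue)" for t
  define v where "v x = indicator S x * u x" for x
  have "(\<lambda>x. indicator S x *\<^sub>R u x) \<in> borel_measurable borel"
    using S(1,2) u by (intro borel_measurable_continuous_on_indicator)
      (auto intro: continuous_on_subset borel_compact)
  then have v[measurable]: "v \<in> borel_measurable borel"
    unfolding v_def[abs_def] by simp
  have [measurable]: "\<phi> \<in> borel_measurable borel"
    using test_function_derivative(3)[OF t] by (rule borel_measurable_continuous_onI)
  have int\<phi>: "integrable lebesgue \<phi>"
    by (rule integrable_test_function[OF t A(1)]) (rule \<phi>(1))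
  obtain B where B: "\<And>x. \<bar>v x\<bar> \<le> B"
  proof -
    have "bounded (u ` S)"
      using S u by (intro compact_imp_bounded compact_continuous_image) (auto intro: continuous_on_subset)
    then obtain B where "\<forall>x\<in>S. \<bar>u x\<bar> \<le> B" by (auto simp: bounded_iff)
    then have "\<bar>v x\<bar> \<le> max 0 B" for x
      by (cases "x \<in> S") (auto simp: v_def le_max_iff_disj)
    then show ?thesis by (rule that)
  qed
  have intv: "integrable lebesgue (\<lambda>y. \<phi> y * v (y - t *\<^sub>R h))" for t
    by (rule integrable_bounded_mult[OF int\<phi> _ B]) (auto intro!: borel_measurable_lebesgueI)
  have \<Psi>: "\<Psi> t = (\<integral>y. \<phi> y * v (y - t *\<^sub>R h) \<partial>lebesgue)" for t
  proof -
    have "(\<lambda>y. \<phi> y * v (y - t *\<^sub>R h)) \<in> borel_measurable borel" by measurable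
    moreover have "\<Psi> t = (\<integral>y. \<phi> (y + t *\<^sub>R h) * v y \<partial>lebesgue)"
      by (simp add: \<Psi>_def v_def mult.commute)
    ultimately show ?thesis
      using integral_lebesgue_translate[of "\<lambda>y. \<phi> y * v (y - t *\<^sub>R h)" "t *\<^sub>R h"] by simp
  qed
  \<comment> \<open>the increment from y - t h to y costs at most t times the support function\<close>
  have low: "\<Psi> t - \<Psi> 0 \<ge> - (t * support_fun K h * I)" if "0 < t" "t * norm h \<le> d" for t
  proof -
    have "- (t * support_fun K h * I) = (\<integral>y. - (t * support_fun K h) * \<phi> y \<partial>lebesgue)"
      by (simp add: I_def)
    also have "\<dots> \<le> (\<integral>y. \<phi> y * v (y - t *\<^sub>R h) - \<phi> y * v (y - 0 *\<^sub>R h) \<partial>lebesgue)"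
    proof (rule integral_mono)
      fix y
      show "- (t * support_fun K h) * \<phi> y \<le> \<phi> y * v (y - t *\<^sub>R h) - \<phi> y * v (y - 0 *\<^sub>R h)"
      proof (cases "y \<in> A")
        case True
        have "y - t *\<^sub>R h \<in> S" "y \<in> S"
          using S(3,4) True that AS by (auto simp: dist_norm)
        moreover from this have "u y - u (y - t *\<^sub>R h) \<le> t * support_fun K h"
          using inc[of "y - t *\<^sub>R h" y] S(2) that support_fun_scale[OF K, of t h] by auto
        ultimately have "- (t * support_fun K h) \<le> v (y - t *\<^sub>R h) - v y"
          by (simp add: v_def)
        from mult_left_mono[OF this \<phi>(2)[of y]] show ?thesis
          by (simp add: algebra_simps)
      qed (simp add: \<phi>(1))
    qed (use int\<phi> intv[of t] intv[of 0] in auto)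
    also have "\<dots> = \<Psi> t - \<Psi> 0"
      unfolding \<Psi> using intv[of t] intv[of 0] by simp
    finally show ?thesis .
  qed
  have "(\<Psi> has_real_derivative - G) (at 0)"
    unfolding \<Psi>_def G_def
    by (rule weak_gradient_translate_derivative[OF w t S(1) S\<Omega>]) (rule zS)
  then have "((\<lambda>t. (\<Psi> t - \<Psi> 0) / t) \<longlongrightarrow> - G) (at_right 0)"
    by (auto simp: DERIV_def intro: tendsto_within_subset)
  moreover have "\<forall>\<^sub>F t in at_right 0. - (support_fun K h * I) \<le> (\<Psi> t - \<Psi> 0) / t"
    unfolding eventually_at_right_field
  proof (intro exI conjI allI impI)
    show "0 < d / (norm h + 1)" using S(3) by (simp add: add_nonneg_pos)
    fix t assume t: "0 < t" "t < d / (norm h + 1)"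
    have "t * norm h \<le> t * (norm h + 1)" using t by simp
    also have "\<dots> \<le> d"
      using t pos_less_divide_eq[of "norm h + 1" t d] by (simp add: add_nonneg_pos)
    finally show "- (support_fun K h * I) \<le> (\<Psi> t - \<Psi> 0) / t"
      using low[of t] t by (simp add: field_simps)
  qed
  ultimately have "- (support_fun K h * I) \<le> - G"
    by (rule tendsto_lowerbound) simp
  moreover have "G = (\<integral>x. indicator A x * (g x \<bullet> h) * \<phi> x \<partial>lebesgue)"
    unfolding G_def using AS \<phi>(1)
    by (intro Bochner_Integration.integral_cong) (auto simp: indicator_def)
  ultimately show ?thesis by (simp add: I_def)
qed

text \<open>Lebesgue's differentiation theorem for cubes with a corner at \<open>x\<close>; an open set is a countable
union of boxes.\<close>

lemma AE_lebesgue_le_if_box_integrals_le: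
  fixes f :: "'a::euclidean_space \<Rightarrow> real"
  assumes W: "open W"
    and int: "\<And>a b. cbox a b \<subseteq> W \<Longrightarrow> integrable lebesgue (\<lambda>x. indicator (cbox a b) x * f x)"
    and le: "\<And>a b. cbox a b \<subseteq> W \<Longrightarrow> (\<integral>x. indicator (box a b) x * f x \<partial>lebesgue) \<le> 0"
  shows "AE x in lebesgue. x \<in> W \<longrightarrow> f x \<le> 0"
proof -
  have main: "AE x in lebesgue. x \<in> cbox a b \<longrightarrow> f x \<le> 0" if ab: "cbox a b \<subseteq> W" for a b
  proof -
    define F where "F x = indicator (cbox a b) x * f x" for x
    have iF: "integrable lebesgue F" unfolding F_def[abs_def] by (rule int[OF ab])
    have "F integrable_on cbox c d" for c d
      using integrable_on_lebesgue[OF iF] integrable_on_subcbox by blast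
    from integrable_ccontinuous_explicit[OF this]
    obtain N where N: "negligible N"
       "\<And>x e. \<lbrakk>x \<notin> N; 0 < e\<rbrakk> \<Longrightarrow> \<exists>d>0. \<forall>h. 0 < h \<and> h < d \<longrightarrow>
           norm (integral (cbox x (x + h *\<^sub>R One)) F /\<^sub>R h ^ DIM('a) - F x) < e"
      by blast
    have int_le: "integral (cbox c d) F \<le> 0" if cd: "cbox c d \<subseteq> cbox a b" for c d
    proof -
      have "integral (cbox c d) F = integral (box c d) F"
        by (rule integral_open_interval[symmetric])
      also have "\<dots> = (LINT x:box c d|lebesgue. F x)"
        using iF by (intro set_lebesgue_integral_eq_integral(2)[symmetric])
          (auto simp: set_integrable_def intro!: integrable_mult_indicator[where 'b=real, simplified])
      also have "\<dots> = (\<integral>x. indicator (box c d) x * f x \<partial>lebesgue)"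
        unfolding set_lebesgue_integral_def
        by (intro Bochner_Integration.integral_cong)
          (use cd box_subset_cbox[of c d] in \<open>auto simp: F_def indicator_def\<close>)
      also have "\<dots> \<le> 0" using cd ab by (intro le) auto
      finally show ?thesis .
    qed
    have "f x \<le> 0" if x: "x \<in> box a b" "x \<notin> N" for x
    proof (rule ccontr)
      assume "\<not> f x \<le> 0"
      moreover have Fx: "F x = f x" using x box_subset_cbox[of a b] by (auto simp: F_def)
      ultimately obtain d where d: "d > 0" "\<And>h. 0 < h \<Longrightarrow> h < d \<Longrightarrow>
           norm (integral (cbox x (x + h *\<^sub>R One)) F /\<^sub>R h ^ DIM('a) - F x) < F x"
        using N(2)[OF x(2), of "F x"] by auto
      obtain r where r: "0 < r" "ball x r \<subseteq> box a b"
        using x(1) open_box open_contains_ball by metis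
      \<comment> \<open>small enough for the differentiation theorem and for the cube to stay in the box\<close>
      define h where "h = min (d / 2) (r / 2 / DIM('a))"
      have h: "0 < h" "h < d" "real DIM('a) * h < r"
        using d(1) r(1) by (auto simp: h_def min_def field_simps)
      have "cbox x (x + h *\<^sub>R One) \<subseteq> cbox (x - h *\<^sub>R One) (x + h *\<^sub>R One)"
        using h(1) by (auto simp: cbox_def inner_diff_left inner_add_left intro: order_trans)
      then have "cbox x (x + h *\<^sub>R One) \<subseteq> ball x r"
        using dist_box_centre[of _ x h] h(3) by force
      then have "integral (cbox x (x + h *\<^sub>R One)) F \<le> 0"
        using r(2) box_subset_cbox[of a b] by (intro int_le) auto
      then have "integral (cbox x (x + h *\<^sub>R One)) F /\<^sub>R h ^ DIM('a) \<le> 0"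
        using h(1) by (simp add: mult_nonneg_nonpos)
      then show False using d(2)[OF h(1,2)] by (simp add: abs_real_def split: if_splits)
    qed
    moreover have "negligible (N \<union> (cbox a b - box a b))"
      using N(1) negligible_frontier_interval by auto
    ultimately show ?thesis
      by (intro AE_I'[of "N \<union> (cbox a b - box a b)"]) (auto simp: negligible_iff_null_sets)
  qed
  show ?thesis
  proof (rule open_countable_Union_open_cbox[OF W])
    fix \<D> :: "'a set set"
    assume D: "countable \<D>" "\<D> \<subseteq> Pow W" "\<And>X. X \<in> \<D> \<Longrightarrow> \<exists>a b. X = cbox a b" "\<Union>\<D> = W"
    have "AE x in lebesgue. \<forall>X\<in>\<D>. x \<in> X \<longrightarrow> f x \<le> 0"
      unfolding AE_ball_countable[OF D(1)]
    proof
      fix X assume X: "X \<in> \<D>"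
      obtain a b where "X = cbox a b" using D(3)[OF X] by (elim exE)
      moreover have "X \<subseteq> W" using D(2) X by auto
      ultimately show "AE x in lebesgue. x \<in> X \<longrightarrow> f x \<le> 0" using main by simp
    qed
    then show "AE x in lebesgue. x \<in> W \<longrightarrow> f x \<le> 0"
      by eventually_elim (use D(4) in auto)
  qed
qed

text \<open>These functions are smooth, take values between 0 and 1 and are supported in the box, so they
allow one to pass from test functions to integrals over boxes.\<close>

lemma bump_power_tendsto_indicator:
  "(\<lambda>n. 1 - (1 - bump a b x) ^ n) \<longlonglongrightarrow> indicator (box a b) x"
proof (cases "x \<in> box a b")
  case True
  then have "(\<lambda>n. (1 - bump a b x) ^ n) \<longlonglongrightarrow> 0"
    using bump_pos bump_le_1 by (intro LIMSEQ_realpow_zero) (auto simp: less_imp_le)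
  from tendsto_diff[OF tendsto_const[of 1] this] True show ?thesis by simp
qed (simp add: bump_eq_0)

text \<open>For each direction \<open>h\<close> the inequality \<open>g z \<bullet> h \<le> support_fun K h\<close> holds in the mean
over all boxes, hence almost everywhere; countably many directions determine \<open>K\<close>. In particular
it applies to an arbitrary weak gradient of \<open>u\<close>, so it also replaces the uniqueness of weak
gradients.\<close>

lemma weak_gradient_mem_if_increments_le:
  fixes u :: "'a::euclidean_space \<Rightarrow> real"
  assumes w: "has_weak_gradient \<Omega> u g" and W: "open W" "W \<subseteq> \<Omega>" and u: "continuous_on W u"
    and inc: "\<And>y z. y \<in> W \<Longrightarrow> z \<in> W \<Longrightarrow> u z - u y \<le> support_fun K (z - y)"
    and K: "compact K" "K \<noteq> {}" "convex K"
  shows "AE z in lebesgue. z \<in> W \<longrightarrow> g z \<in> K"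
proof -
  have gl: "(\<lambda>x. g x \<bullet> h) locally_integrable_on \<Omega>" for h
    using w by (auto simp: has_weak_gradient_def intro: locally_integrable_inner)
  have dir: "AE z in lebesgue. z \<in> W \<longrightarrow> g z \<bullet> h - support_fun K h \<le> 0" for h
  proof (rule AE_lebesgue_le_if_box_integrals_le[OF W(1)])
    fix a b assume ab: "cbox a b \<subseteq> W"
    define c where "c = support_fun K h"
    have ig: "integrable lebesgue (\<lambda>x. indicator (cbox a b) x * (g x \<bullet> h))"
      using ab W(2) by (intro locally_integrable_cutoff[OF gl]) auto
    have i1: "integrable lebesgue (\<lambda>x. indicator (cbox a b) x * (1::real))"
      by (auto simp flip: lmeasurable_iff_integrable)
    from ig i1 show "integrable lebesgue (\<lambda>x. indicator (cbox a b) x * (g x \<bullet> h - support_fun K h))"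
      by (auto simp: right_diff_distrib simp del: indicator_simps)
    define \<phi> where "\<phi> n x = 1 - (1 - bump a b x) ^ n" for n x
    have lim: "(\<lambda>n. \<phi> n x) \<longlonglongrightarrow> indicator (box a b) x" for x
      unfolding \<phi>_def by (rule bump_power_tendsto_indicator)
    have pw: "0 \<le> (1 - bump a b x) ^ n" "(1 - bump a b x) ^ n \<le> 1" for n x
      using bump_le_1[of a b x] bump_nonneg[of a b x] by (auto intro: power_le_one)
    have bd: "0 \<le> \<phi> n x" "\<bar>\<phi> n x\<bar> \<le> 1" for n x
      unfolding \<phi>_def using pw[where n=n and x=x] by linarith+
    have z: "\<phi> n x = 0" if "x \<notin> cbox a b" for n x
    proof -
      have "x \<notin> box a b" using that box_subset_cbox[of a b] by blast
      then show ?thesis by (simp add: \<phi>_def bump_eq_0)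
    qed
    have test: "test_function \<Omega> (\<phi> n)" for n
    proof (rule test_functionI[of _ a b])
      show "k_times_cont_diff k (\<phi> n)" for k
        unfolding \<phi>_def[abs_def]
        by (intro k_times_cont_diff_diff k_times_cont_diff_power k_times_cont_diff_const k_times_cont_diff_bump)
    qed (use z ab W in auto)
    have meas: "\<phi> n \<in> borel_measurable lebesgue" for n
      by (intro continuous_borel_measurable_lebesgue test_function_derivative(3)[OF test])
    have mbox: "(indicator (box a b) :: 'a \<Rightarrow> real) \<in> borel_measurable lebesgue"
      by (intro borel_measurable_lebesgueI borel_measurable_indicator borel_open open_box)
    have "(\<lambda>n. \<integral>x. indicator (cbox a b) x * (g x \<bullet> h) * \<phi> n x \<partial>lebesgue) \<longlonglongrightarrow>
        (\<integral>x. indicator (cbox a b) x * (g x \<bullet> h) * indicator (box a b) x \<partial>lebesgue)"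
    proof (rule integral_dominated_convergence[where w="\<lambda>x. \<bar>indicator (cbox a b) x * (g x \<bullet> h)\<bar>"])
      show "AE x in lebesgue. norm (indicator (cbox a b) x * (g x \<bullet> h) * \<phi> n x) \<le> \<bar>indicator (cbox a b) x * (g x \<bullet> h)\<bar>" for n
        using bd(2) by (auto simp: abs_mult intro!: mult_left_le)
      show "AE x in lebesgue. (\<lambda>n. indicator (cbox a b) x * (g x \<bullet> h) * \<phi> n x) \<longlonglongrightarrow>
         indicator (cbox a b) x * (g x \<bullet> h) * indicator (box a b) x"
        by (intro always_eventually allI tendsto_mult tendsto_const lim)
      show "(\<lambda>x. indicator (cbox a b) x * (g x \<bullet> h) * \<phi> n x) \<in> borel_measurable lebesgue" for n
        by (intro borel_measurable_times[OF borel_measurable_integrable[OF ig] meas])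
      show "(\<lambda>x. indicator (cbox a b) x * (g x \<bullet> h) * indicator (box a b) x) \<in> borel_measurable lebesgue"
        by (intro borel_measurable_times[OF borel_measurable_integrable[OF ig] mbox])
    qed (use ig in auto)
    moreover have "(\<lambda>n. c * (\<integral>x. \<phi> n x \<partial>lebesgue)) \<longlonglongrightarrow> c * (\<integral>x. indicator (box a b) x \<partial>lebesgue)"
    proof (rule tendsto_mult[OF tendsto_const],
        rule integral_dominated_convergence[where w="\<lambda>x. indicator (cbox a b) x * 1"])
      show "AE x in lebesgue. norm (\<phi> n x) \<le> indicator (cbox a b) x * 1" for n
        using bd(2) z by (auto simp: indicator_def)
    qed (use i1 lim meas mbox in auto)
    moreover have "(\<integral>x. indicator (cbox a b) x * (g x \<bullet> h) * \<phi> n x \<partial>lebesgue) \<le> c * (\<integral>x. \<phi> n x \<partial>lebesgue)" for n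
      unfolding c_def
      by (rule weak_gradient_tested_le[OF w W u inc K(1,2) compact_cbox ab test z bd(1)])
    ultimately have "(\<integral>x. indicator (cbox a b) x * (g x \<bullet> h) * indicator (box a b) x \<partial>lebesgue)
        \<le> c * (\<integral>x. indicator (box a b) x \<partial>lebesgue)"
      by (intro LIMSEQ_le) auto
    moreover have "(\<integral>x. indicator (box a b) x * (g x \<bullet> h - c) \<partial>lebesgue) =
       (\<integral>x. indicator (cbox a b) x * (g x \<bullet> h) * indicator (box a b) x - c * indicator (box a b) x \<partial>lebesgue)"
      using box_subset_cbox[of a b]
      by (intro Bochner_Integration.integral_cong) (auto simp: indicator_def)
    moreover have "integrable lebesgue (\<lambda>x. indicator (cbox a b) x * (g x \<bullet> h) * indicator (box a b) x)"
      using ig mbox by (rule integrable_bounded_mult[where B=1]) (auto simp: indicator_def)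
    moreover have "integrable lebesgue (\<lambda>x. c * indicator (box a b) x)"
      by (intro integrable_mult_right) (auto simp flip: lmeasurable_iff_integrable)
    ultimately show "(\<integral>x. indicator (box a b) x * (g x \<bullet> h - support_fun K h) \<partial>lebesgue) \<le> 0"
      by (simp add: c_def)
  qed
  obtain D :: "'a set" where D: "countable D" "\<And>X. open X \<Longrightarrow> X \<noteq> {} \<Longrightarrow> \<exists>d\<in>D. d \<in> X"
    using countable_dense_exists by blast
  have "closure D = UNIV"
  proof (rule ccontr)
    assume "closure D \<noteq> UNIV"
    then obtain d where "d \<in> D" "d \<in> - closure D"
      using D(2)[of "- closure D"] by auto
    then show False using closure_subset by auto
  qed
  moreover have "AE z in lebesgue. \<forall>h\<in>D. z \<in> W \<longrightarrow> g z \<bullet> h - support_fun K h \<le> 0"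
    unfolding AE_ball_countable[OF D(1)] using dir by blast
  ultimately show ?thesis
    by (auto elim!: eventually_mono intro!: mem_if_inner_le_support_fun[OF K(1,3,2)])
qed

lemma locally_integrable_continuous:
  assumes "continuous_on W f"
  shows "f locally_integrable_on W"
  unfolding locally_integrable_on_def set_integrable_def
proof (intro allI impI)
  fix K assume "compact K \<and> K \<subseteq> W"
  then have i: "integrable lborel (\<lambda>x. indicator K x *\<^sub>R f x)"
    using assms by (intro borel_integrable_compact) (auto intro: continuous_on_subset)
  from borel_measurable_integrable[OF this] i
  show "integrable lebesgue (\<lambda>x. indicator K x *\<^sub>R f x)"
    by (simp add: integrable_completion)
qed

text \<open>The product \<open>v x * \<phi> x\<close>, extended by zero, is continuously differentiable with compact
support. Its integral does not change under translation, and the derivative of this constant is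
the integration by parts formula.\<close>

lemma has_weak_gradient_continuously_differentiable:
  fixes v :: "'a::euclidean_space \<Rightarrow> real"
  assumes W: "open W" and v: "\<And>x. x \<in> W \<Longrightarrow> (v has_derivative (\<lambda>h. g x \<bullet> h)) (at x)"
    and g: "continuous_on W g"
  shows "has_weak_gradient W v g"
  unfolding has_weak_gradient_def
proof (intro conjI allI impI ballI)
  have cv: "continuous_on W v"
    using v W by (auto simp: continuous_on_eq_continuous_at intro: has_derivative_continuous)
  show "v locally_integrable_on W" "g locally_integrable_on W"
    using cv g by (auto intro: locally_integrable_continuous)
  fix \<phi> :: "'a \<Rightarrow> real" and i :: 'a
  assume t: "test_function W \<phi>" and i: "i \<in> Basis"
  note d = test_function_derivative[OF t]
  define S where "S = closure {x. \<phi> x \<noteq> 0}"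
  have S: "compact S" "S \<subseteq> W" using t by (auto simp: S_def test_function_def)
  have zS: "\<phi> x = 0" if "x \<notin> S" for x
    using that closure_subset[of "{x. \<phi> x \<noteq> 0}"] by (auto simp: S_def)
  have zd: "frechet_derivative \<phi> (at x) i = 0" if "x \<notin> S" for x
    by (rule frechet_derivative_eq_0_outside[OF d(1) compact_imp_closed[OF S(1)] zS that])
  show "(LINT x:W|lebesgue. v x * frechet_derivative \<phi> (at x) i) = - (LINT x:W|lebesgue. g x \<bullet> i * \<phi> x)"
  proof (cases "S = {}")
    case True
    then have "\<phi> x = 0" "frechet_derivative \<phi> (at x) i = 0" for x using zS zd by auto
    then show ?thesis by simp
  next
    case False
    define F where "F x = (if x \<in> W then v x * \<phi> x else 0)" for x
    define D where "D x = (if x \<in> W then v x * frechet_derivative \<phi> (at x) i + (g x \<bullet> i) * \<phi> x else 0)" for x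
    have zF: "F x = 0" "D x = 0" if "x \<notin> S" for x
      using that zS zd by (auto simp: F_def D_def)
    have open': "open (- S)" using S(1) by (simp add: compact_imp_closed open_Compl)
    have UN: "W \<union> - S = UNIV" using S(2) by auto
    have cont: "continuous_on UNIV f" if "continuous_on W f" "\<And>x. x \<notin> S \<Longrightarrow> f x = 0" for f :: "'a \<Rightarrow> real"
    proof -
      have "continuous_on (- S) f"
        using that(2) by (subst continuous_on_cong[where g="\<lambda>_. 0"]) auto
      then show ?thesis using continuous_on_open_Un[OF W open' that(1)] UN by simp
    qed
    have cF: "continuous_on UNIV F"
    proof (rule cont)
      have "continuous_on W (\<lambda>x. v x * \<phi> x)"
        using cv d(3) by (intro continuous_intros) (auto intro: continuous_on_subset)
      then show "continuous_on W F" by (rule continuous_on_eq) (simp add: F_def)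
    qed (rule zF)
    have cD: "continuous_on UNIV D"
    proof (rule cont)
      have "continuous_on W (\<lambda>x. v x * frechet_derivative \<phi> (at x) i + (g x \<bullet> i) * \<phi> x)"
        using cv d(2)[of i] d(3) g by (intro continuous_intros) (auto intro: continuous_on_subset)
      then show "continuous_on W D" by (rule continuous_on_eq) (simp add: D_def)
    qed (rule zF)
    obtain A where A: "\<And>x. \<bar>F x\<bar> \<le> A"
      using continuous_bounded_outside_compact[OF cF S(1) zF(1)] by blast
    obtain B where B: "\<And>x. \<bar>D x\<bar> \<le> B"
      using continuous_bounded_outside_compact[OF cD S(1) zF(2)] by blast
    have der: "((\<lambda>t. F (x + t *\<^sub>R i)) has_real_derivative D (x + t *\<^sub>R i)) (at t)" for x t
    proof -
      let ?y = "x + t *\<^sub>R i"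
      have "\<exists>F'. (F has_derivative F') (at ?y) \<and> F' i = D ?y"
      proof (cases "?y \<in> W")
        case True
        have "((\<lambda>x. v x * \<phi> x) has_derivative
            (\<lambda>h. v ?y * frechet_derivative \<phi> (at ?y) h + (g ?y \<bullet> h) * \<phi> ?y)) (at ?y)"
          by (rule has_derivative_mult[OF v[OF True] d(1)])
        then have "(F has_derivative
            (\<lambda>h. v ?y * frechet_derivative \<phi> (at ?y) h + (g ?y \<bullet> h) * \<phi> ?y)) (at ?y)"
          by (rule has_derivative_transform_within_open[OF _ W True]) (simp add: F_def)
        then show ?thesis using True by (auto simp: D_def)
      next
        case False
        have "(F has_derivative (\<lambda>h. 0)) (at ?y)"
          by (rule has_derivative_transform_within_open[of "\<lambda>_. 0" _ _ _ "- S"])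
            (use False S(2) open' zF in auto)
        then show ?thesis using False by (auto simp: D_def)
      qed
      then obtain F' where F': "(F has_derivative F') (at ?y)" "F' i = D ?y" by blast
      interpret linear F' by (rule has_derivative_linear[OF F'(1)])
      have "((\<lambda>t. F (x + t *\<^sub>R i)) has_derivative (\<lambda>s. F' (s *\<^sub>R i))) (at t)"
        by (rule has_derivative_compose[where g=F and f="\<lambda>t. x + t *\<^sub>R i", OF _ F'(1)]) (auto intro!: derivative_eq_intros)
      then show ?thesis
        by (simp add: has_field_derivative_def scale F'(2) mult.commute[of _ "D _"])
    qed
    obtain S' e where S': "compact S'" "S' \<subseteq> (UNIV::'a set)" "0 < e"
        "\<And>x y. x \<in> S \<Longrightarrow> dist x y \<le> e \<Longrightarrow> y \<in> S'"
      by (rule compact_neighbourhood_in_open[OF S(1) open_UNIV _ False]) auto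
    have int1: "integrable lebesgue (indicator S' :: 'a \<Rightarrow> real)"
      using S'(1) by (auto simp flip: lmeasurable_iff_integrable intro: lmeasurable_compact)
    have translated: "((\<lambda>t. \<integral>x. indicator S' x * F (x + t *\<^sub>R i) \<partial>lebesgue) has_real_derivative
        (\<integral>x. indicator S' x * D x \<partial>lebesgue)) (at 0)"
      by (rule has_real_derivative_integral_translate[OF int1 der cF cD A B])
    have "(\<integral>x. indicator S' x * F (x + t *\<^sub>R i) \<partial>lebesgue) = (\<integral>x. F x \<partial>lebesgue)"
      if "t \<in> {- e<..<e}" for t
    proof -
      have "indicator S' x * F (x + t *\<^sub>R i) = F (x + t *\<^sub>R i)" for x
        using S'(4)[of "x + t *\<^sub>R i" x] zF(1)[of "x + t *\<^sub>R i"] that i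
        by (cases "x + t *\<^sub>R i \<in> S") (auto simp: dist_norm abs_le_iff)
      then have "(\<lambda>x. indicator S' x * F (x + t *\<^sub>R i)) = (\<lambda>x. F (x + t *\<^sub>R i))"
        by (rule ext)
      then show ?thesis
        by (simp only: integral_lebesgue_translate[OF borel_measurable_continuous_onI[OF cF]])
    qed
    note const = this
    have "((\<lambda>t::real. \<integral>x. F x \<partial>lebesgue) has_real_derivative (\<integral>x. indicator S' x * D x \<partial>lebesgue)) (at 0)"
      by (rule has_field_derivative_transform_within_open[OF translated, of "{- e<..<e}"])
        (use S'(3) const in auto)
    then have D0: "(\<integral>x. indicator S' x * D x \<partial>lebesgue) = 0"
      by (metis DERIV_const DERIV_unique)
    have "S \<subseteq> S'" using S'(3,4) by force
    then have "(\<integral>x. indicator S' x * D x \<partial>lebesgue) =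
       (\<integral>x. indicator S x * v x * frechet_derivative \<phi> (at x) i + indicator S x * (g x \<bullet> i) * \<phi> x \<partial>lebesgue)"
    proof (intro Bochner_Integration.integral_cong refl)
      fix x assume SS': "S \<subseteq> S'"
      show "indicator S' x * D x =
          indicator S x * v x * frechet_derivative \<phi> (at x) i + indicator S x * (g x \<bullet> i) * \<phi> x"
      proof (cases "x \<in> S")
        case True
        then have "x \<in> W" "x \<in> S'" using S(2) SS' by auto
        with True show ?thesis by (simp add: D_def)
      qed (simp add: zF(2))
    qed
    also have "\<dots> = (\<integral>x. indicator S x * v x * frechet_derivative \<phi> (at x) i \<partial>lebesgue) +
       (\<integral>x. indicator S x * (g x \<bullet> i) * \<phi> x \<partial>lebesgue)"
    proof (rule Bochner_Integration.integral_add)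
      obtain B1 where B1: "\<And>x. \<bar>frechet_derivative \<phi> (at x) i\<bar> \<le> B1"
        using continuous_bounded_outside_compact[OF d(2) S(1) zd] by blast
      obtain B2 where B2: "\<And>x. \<bar>\<phi> x\<bar> \<le> B2"
        using continuous_bounded_outside_compact[OF d(3) S(1) zS] by blast
      show "integrable lebesgue (\<lambda>x. indicator S x * v x * frechet_derivative \<phi> (at x) i)"
        by (intro integrable_bounded_mult[OF _ _ B1] locally_integrable_cutoff[OF \<open>v locally_integrable_on W\<close> S]
            continuous_borel_measurable_lebesgue d(2))
      show "integrable lebesgue (\<lambda>x. indicator S x * (g x \<bullet> i) * \<phi> x)"
        by (intro integrable_bounded_mult[OF _ _ B2] locally_integrable_cutoff[OF _ S]
            locally_integrable_inner \<open>g locally_integrable_on W\<close> continuous_borel_measurable_lebesgue d(3))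
    qed
    finally show ?thesis
      using D0 LINT_cutoff[OF S(2), of "\<lambda>x. frechet_derivative \<phi> (at x) i"] LINT_cutoff[OF S(2), of \<phi>] zd zS
      by simp
  qed
qed

lemma locally_integrable_measurable:
  fixes g :: "'a::euclidean_space \<Rightarrow> 'b::euclidean_space"
  assumes g: "g locally_integrable_on \<Omega>" and W: "open W" "W \<subseteq> \<Omega>"
  shows "g \<in> borel_measurable (lebesgue_on W)"
proof -
  obtain C :: "nat \<Rightarrow> 'a set" where C: "\<And>n. compact (C n)" "\<And>n. C n \<subseteq> W"
    "\<And>K. compact K \<Longrightarrow> K \<subseteq> W \<Longrightarrow> \<exists>N. \<forall>n\<ge>N. K \<subseteq> C n"
    by (rule open_Union_compact_subsets[OF W(1)]) blast
  have "(\<lambda>x. indicator W x *\<^sub>R g x) \<in> borel_measurable lebesgue"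
  proof (rule borel_measurable_LIMSEQ_metric)
    fix n
    show "(\<lambda>x. indicator (C n) x *\<^sub>R g x) \<in> borel_measurable lebesgue"
      using g C(1,2) W(2) unfolding locally_integrable_on_def set_integrable_def
      by (meson borel_measurable_integrable order_trans)
  next
    fix x
    have "\<forall>\<^sub>F n in sequentially. indicator (C n) x *\<^sub>R g x = indicator W x *\<^sub>R g x"
    proof (cases "x \<in> W")
      case True
      then obtain N where "\<forall>n\<ge>N. {x} \<subseteq> C n" using C(3)[of "{x}"] by auto
      then show ?thesis using True by (auto simp: eventually_sequentially intro!: exI[of _ N])
    next
      case False
      then have "x \<notin> C n" for n using C(2) by auto
      with False show ?thesis by simp
    qed
    then show "(\<lambda>n. indicator (C n) x *\<^sub>R g x) \<longlonglongrightarrow> indicator W x *\<^sub>R g x"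
      by (rule tendsto_eventually)
  qed
  then show ?thesis
    using W(1) by (subst borel_measurable_restrict_space_iff) auto
qed

lemma Linf_loc_continuous:
  fixes f :: "'a::euclidean_space \<Rightarrow> 'b::euclidean_space"
  assumes "open W" "continuous_on W f"
  shows "f \<in> Linf_loc W"
  unfolding Linf_loc_def
proof (intro CollectI conjI allI impI)
  show "f \<in> borel_measurable (lebesgue_on W)"
    using assms by (intro continuous_imp_measurable_on_sets_lebesgue) auto
  fix K assume K: "compact K \<and> K \<subseteq> W"
  then have "bounded (f ` K)"
    using assms by (intro compact_imp_bounded compact_continuous_image) (auto intro: continuous_on_subset)
  then obtain C where C: "\<forall>x\<in>K. norm (f x) \<le> C" by (auto simp: bounded_iff)
  have "AE x in lebesgue_on K. norm (f x) \<le> C"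
    by (rule AE_I2) (use C in auto)
  then show "\<exists>C. AE x in lebesgue_on K. norm (f x) \<le> C" ..
qed

lemma has_weak_gradient_weak_gradient:
  "u \<in> W1inf_loc \<Omega> \<Longrightarrow> has_weak_gradient \<Omega> u (weak_gradient \<Omega> u)"
  unfolding W1inf_loc_def weak_gradient_def by (auto intro: someI[of "has_weak_gradient \<Omega> u"])

lemma AE_lebesgue_on_open:
  "open W \<Longrightarrow> (AE x in lebesgue_on W. P x) \<longleftrightarrow> (AE x in lebesgue. x \<in> W \<longrightarrow> P x)"
  by (rule AE_restrict_space_iff) auto

section \<open>The cones of a Hamiltonian\<close>

locale segment_free_hamiltonian =
  fixes H :: "'a::euclidean_space \<Rightarrow> real"
  assumes continuous_H: "continuous_on UNIV H"
    and convex_H: "convex_on UNIV H"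
    and coercive_H: "filterlim H at_top at_infinity"
    and no_segment: "a \<noteq> b \<Longrightarrow> \<not> closed_segment a b \<subseteq> H -` {c}"
begin

definition sublevel :: "real \<Rightarrow> 'a set" where
  "sublevel c = {p. H p \<le> c}"

lemma closed_sublevel: "closed (sublevel c)"
  unfolding sublevel_def by (intro closed_Collect_le continuous_H continuous_intros)

lemma compact_sublevel: "compact (sublevel c)"
proof -
  have "eventually (\<lambda>p. H p > c) at_infinity"
    using coercive_H by (simp add: filterlim_at_top_dense)
  then obtain b where "\<forall>p. b \<le> norm p \<longrightarrow> H p > c"
    by (auto simp: eventually_at_infinity)
  then have "\<forall>p\<in>sublevel c. norm p \<le> b"
    unfolding sublevel_def by (metis linorder_le_cases mem_Collect_eq not_le)
  then show ?thesis
    using closed_sublevel by (auto simp: compact_eq_bounded_closed bounded_iff)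
qed

lemma convex_sublevel: "convex (sublevel c)"
  unfolding convex_alt
proof (intro ballI allI impI)
  fix p q t assume pq: "p \<in> sublevel c" "q \<in> sublevel c" and t: "(0::real) \<le> t \<and> t \<le> 1"
  have "H ((1 - t) *\<^sub>R p + t *\<^sub>R q) \<le> (1 - t) * H p + t * H q"
    using convex_onD[OF convex_H] t by auto
  also have "\<dots> \<le> c"
    using pq t by (intro convex_bound_le) (auto simp: sublevel_def)
  finally show "(1 - t) *\<^sub>R p + t *\<^sub>R q \<in> sublevel c" by (simp add: sublevel_def)
qed

lemma sublevel_mono: "c \<le> d \<Longrightarrow> sublevel c \<subseteq> sublevel d"
  by (auto simp: sublevel_def)

definition argmin_H :: 'a where
  "argmin_H = (SOME p. \<forall>q. H p \<le> H q)"

abbreviation min_H :: real where "min_H \<equiv> H argmin_H"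

text \<open>Coercivity makes the sublevel set at \<open>H 0\<close> compact, and a minimum over it is global.\<close>

lemma min_H_le: "min_H \<le> H q"
proof -
  obtain p where p: "p \<in> sublevel (H 0)" "\<forall>q\<in>sublevel (H 0). H p \<le> H q"
    using continuous_attains_inf[OF compact_sublevel[of "H 0"], of H] continuous_H
    by (auto simp: sublevel_def intro: continuous_on_subset)
  then have "\<forall>q. H p \<le> H q"
    unfolding sublevel_def by (metis linorder_le_cases mem_Collect_eq order_trans)
  then have "\<forall>q. min_H \<le> H q"
    unfolding argmin_H_def by (rule someI)
  then show ?thesis ..
qed

lemma sublevel_nonempty: "min_H \<le> c \<Longrightarrow> sublevel c \<noteq> {}"
  by (auto simp: sublevel_def)

text \<open>The lowest nonempty sublevel set is a level set and convex, so it cannot contain two points.\<close>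

lemma sublevel_min_H: "sublevel min_H = {argmin_H}"
proof -
  have "p = argmin_H" if p: "p \<in> sublevel min_H" for p
  proof (rule ccontr)
    assume "p \<noteq> argmin_H"
    then have "\<not> closed_segment p argmin_H \<subseteq> H -` {min_H}" by (rule no_segment)
    moreover have "closed_segment p argmin_H \<subseteq> sublevel min_H"
      using p convex_sublevel by (intro closed_segment_subset) (auto simp: sublevel_def)
    moreover have "sublevel min_H \<subseteq> H -` {min_H}"
      using min_H_le by (auto simp: sublevel_def intro: antisym)
    ultimately show False by blast
  qed
  then show ?thesis by (auto simp: sublevel_def)
qed

text \<open>The origin need not minimise \<open>H\<close>, so a cone may take negative values. Below the level \<open>min_H\<close>
the supremum is over the empty set and the value carries no meaning.\<close>

definition Hcone :: "real \<Rightarrow> 'a \<Rightarrow> real" where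
  "Hcone c = support_fun (sublevel c)"

lemma Hcone_ge: "H p \<le> c \<Longrightarrow> p \<bullet> w \<le> Hcone c w"
  unfolding Hcone_def by (rule support_fun_ge[OF compact_sublevel]) (simp add: sublevel_def)

lemma Hcone_scale: "min_H \<le> c \<Longrightarrow> 0 \<le> t \<Longrightarrow> Hcone c (t *\<^sub>R w) = t * Hcone c w"
  unfolding Hcone_def by (intro support_fun_scale compact_sublevel sublevel_nonempty)

lemma Hcone_zero: "min_H \<le> c \<Longrightarrow> Hcone c 0 = 0"
  using Hcone_scale[of c 0 0] by simp

lemma Hcone_diff_le: "min_H \<le> c \<Longrightarrow> Hcone c v - Hcone c w \<le> Hcone c (v - w)"
  unfolding Hcone_def by (intro support_fun_diff_le compact_sublevel sublevel_nonempty)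

lemma continuous_Hcone: "min_H \<le> c \<Longrightarrow> continuous_on S (Hcone c)"
  unfolding Hcone_def by (intro support_fun_continuous compact_sublevel sublevel_nonempty)

text \<open>Two maximisers span a segment of maximisers. Some point of it lies strictly below the level \<open>c\<close>,
and moving this point slightly in direction \<open>w\<close> stays in the sublevel set and beats the maximum.\<close>

lemma maximiser_unique:
  assumes w: "w \<noteq> 0" and p: "H p \<le> c" "p \<bullet> w = Hcone c w" and q: "H q \<le> c" "q \<bullet> w = Hcone c w"
  shows "p = q"
proof (rule ccontr)
  assume "p \<noteq> q"
  then obtain z where z: "z \<in> closed_segment p q" "H z \<noteq> c"
    using no_segment[of p q c] by auto
  have "z \<in> sublevel c"
    using closed_segment_subset[OF _ _ convex_sublevel, of p c q] p q z by (auto simp: sublevel_def)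
  with z have Hz: "H z < c" by (simp add: sublevel_def)
  have zw: "z \<bullet> w = Hcone c w"
  proof -
    obtain t where "z = (1 - t) *\<^sub>R p + t *\<^sub>R q" using z(1) by (auto simp: closed_segment_def)
    then have "z \<bullet> w = (1 - t) * (p \<bullet> w) + t * (q \<bullet> w)" by (simp add: inner_add_left)
    then show ?thesis by (simp add: p q algebra_simps)
  qed
  have "((\<lambda>t. H (z + t *\<^sub>R w)) \<longlongrightarrow> H (z + 0 *\<^sub>R w)) (at_right 0)"
  proof (rule tendsto_within_subset[of _ _ 0 UNIV])
    have "continuous_on UNIV (\<lambda>t. H (z + t *\<^sub>R w))"
      by (intro continuous_on_compose2[OF continuous_H] continuous_intros) auto
    then show "((\<lambda>t. H (z + t *\<^sub>R w)) \<longlongrightarrow> H (z + 0 *\<^sub>R w)) (at 0)"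
      unfolding continuous_on_def by blast
  qed simp
  then have "\<forall>\<^sub>F t in at_right 0. H (z + t *\<^sub>R w) < c"
    using Hz by (intro order_tendstoD(2)) auto
  then obtain b where b: "b > 0" "\<forall>t>0. t < b \<longrightarrow> H (z + t *\<^sub>R w) < c"
    by (auto simp: eventually_at_right_field)
  from b(2)[rule_format, of "b/2"] b(1) have "H (z + (b/2) *\<^sub>R w) \<le> c" by simp
  from Hcone_ge[OF this, of w] have "b / 2 * (w \<bullet> w) \<le> 0"
    by (simp add: inner_add_left zw)
  moreover have "0 < b / 2 * (w \<bullet> w)" using b(1) w by simp
  ultimately show False by simp
qed

definition maximiser :: "real \<Rightarrow> 'a \<Rightarrow> 'a" where
  "maximiser c w = (SOME p. H p \<le> c \<and> p \<bullet> w = Hcone c w)"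

lemma maximiser:
  assumes "min_H \<le> c"
  shows "H (maximiser c w) \<le> c" "maximiser c w \<bullet> w = Hcone c w"
proof -
  obtain p where "p \<in> sublevel c" "support_fun (sublevel c) w = p \<bullet> w"
    by (rule support_fun_attained[OF compact_sublevel sublevel_nonempty[OF assms]])
  then have "H p \<le> c \<and> p \<bullet> w = Hcone c w" by (simp add: Hcone_def sublevel_def)
  then have "H (maximiser c w) \<le> c \<and> maximiser c w \<bullet> w = Hcone c w"
    unfolding maximiser_def by (rule someI)
  then show "H (maximiser c w) \<le> c" "maximiser c w \<bullet> w = Hcone c w" by auto
qed

lemma maximiser_eqI:
  "min_H \<le> c \<Longrightarrow> w \<noteq> 0 \<Longrightarrow> H p \<le> c \<Longrightarrow> p \<bullet> w = Hcone c w \<Longrightarrow> maximiser c w = p"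
  using maximiser[of c w] by (intro maximiser_unique) auto

lemma maximiser_scale:
  assumes "min_H \<le> c" "0 < t" "w \<noteq> 0"
  shows "maximiser c (t *\<^sub>R w) = maximiser c w"
  using assms maximiser[OF assms(1), of w] Hcone_scale[of c t w] by (intro maximiser_eqI) auto

text \<open>A maximiser strictly below the level \<open>c\<close> could be moved further in direction \<open>w\<close>.\<close>

lemma H_maximiser:
  assumes c: "min_H \<le> c" and w: "w \<noteq> 0"
  shows "H (maximiser c w) = c"
proof (rule ccontr)
  let ?p = "maximiser c w"
  assume "H ?p \<noteq> c"
  with maximiser(1)[OF c] have less: "H ?p < c" by (simp add: less_le)
  have "continuous_on UNIV (\<lambda>t. H (?p + t *\<^sub>R w))"
    by (intro continuous_on_compose2[OF continuous_H] continuous_intros) auto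
  then have "((\<lambda>t. H (?p + t *\<^sub>R w)) \<longlongrightarrow> H (?p + 0 *\<^sub>R w)) (at 0)"
    unfolding continuous_on_def by blast
  then have "\<forall>\<^sub>F t in at 0. H (?p + t *\<^sub>R w) < c"
    using less by (intro order_tendstoD(2)) auto
  then obtain d where d: "d > 0" "\<forall>t. t \<noteq> 0 \<and> dist t 0 < d \<longrightarrow> H (?p + t *\<^sub>R w) < c"
    by (auto simp: eventually_at)
  then have "H (?p + (d/2) *\<^sub>R w) \<le> c" by (auto simp: dist_norm intro: less_imp_le)
  from Hcone_ge[OF this, of w] have "d / 2 * (w \<bullet> w) \<le> 0"
    using maximiser(2)[OF c, of w] by (simp add: inner_add_left)
  moreover have "0 < d / 2 * (w \<bullet> w)" using d(1) w by simp
  ultimately show False by simp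
qed

text \<open>The maximisers stay in a compact set, and every cluster point of them is again a maximiser by
continuity of the cone; uniqueness identifies it.\<close>

lemma isCont_maximiser:
  assumes c: "min_H \<le> c" and w: "w \<noteq> 0"
  shows "isCont (maximiser c) w"
proof (rule ccontr)
  assume "\<not> isCont (maximiser c) w"
  then obtain e where e: "0 < e" "\<And>d. d > 0 \<Longrightarrow> \<exists>v. dist v w < d \<and> e \<le> dist (maximiser c v) (maximiser c w)"
    unfolding continuous_at_eps_delta by (meson not_le)
  have "\<exists>v. dist v w < 1 / Suc n \<and> e \<le> dist (maximiser c v) (maximiser c w)" for n
    by (rule e(2)) simp
  then obtain v where v: "\<And>n. dist (v n) w < 1 / Suc n" "\<And>n. e \<le> dist (maximiser c (v n)) (maximiser c w)"
    by metis
  have "\<forall>n. maximiser c (v n) \<in> sublevel c" using maximiser(1)[OF c] by (simp add: sublevel_def)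
  then obtain p s where p: "p \<in> sublevel c" and s: "strict_mono s" "((\<lambda>n. maximiser c (v n)) \<circ> s) \<longlonglongrightarrow> p"
    using compact_sublevel[of c] unfolding compact_def by metis
  have "(\<lambda>n. dist (v n) w) \<longlonglongrightarrow> 0"
    by (rule real_tendsto_sandwich[OF _ _ tendsto_const LIMSEQ_inverse_real_of_nat])
      (use v(1) in \<open>auto simp: inverse_eq_divide intro!: always_eventually less_imp_le\<close>)
  then have lv: "v \<longlonglongrightarrow> w" by (subst tendsto_dist_iff)
  have lvs: "(v \<circ> s) \<longlonglongrightarrow> w" by (rule LIMSEQ_subseq_LIMSEQ[OF lv s(1)])
  have "(\<lambda>n. maximiser c (v (s n)) \<bullet> v (s n)) \<longlonglongrightarrow> p \<bullet> w"
    using tendsto_inner[OF s(2) lvs] by (simp add: comp_def)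
  moreover have "(\<lambda>n. Hcone c (v (s n))) \<longlonglongrightarrow> Hcone c w"
    using isCont_tendsto_compose[OF _ lvs, of "Hcone c"] continuous_Hcone[OF c, of UNIV]
    by (simp add: comp_def continuous_on_eq_continuous_at)
  ultimately have "p \<bullet> w = Hcone c w"
    using LIMSEQ_unique by (simp add: maximiser(2)[OF c])
  then have "maximiser c w = p"
    using p w c by (intro maximiser_eqI) (auto simp: sublevel_def)
  then have "(\<lambda>n. dist (maximiser c (v (s n))) (maximiser c w)) \<longlonglongrightarrow> 0"
    using tendsto_dist[OF s(2) tendsto_const[of p]] by (simp add: comp_def)
  then have "e \<le> 0"
    by (rule tendsto_lowerbound) (use v(2) in auto)
  then show False using e(1) by simp
qed

text \<open>Testing the supremum at each of the two points with the maximiser of the other bounds the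
remainder between 0 and the product of \<open>v - w\<close> with the difference of the maximisers.\<close>

lemma Hcone_has_derivative:
  assumes c: "min_H \<le> c" and w: "w \<noteq> 0"
  shows "(Hcone c has_derivative (\<lambda>h. maximiser c w \<bullet> h)) (at w)"
  unfolding has_derivative_at_alt
proof (intro conjI allI impI)
  show "bounded_linear (\<lambda>h. maximiser c w \<bullet> h)" by (rule bounded_linear_inner_right)
  fix e :: real assume "0 < e"
  then have "\<exists>d>0. \<forall>v. dist v w < d \<longrightarrow> dist (maximiser c v) (maximiser c w) < e"
    using isCont_maximiser[OF c w] by (simp add: continuous_at_eps_delta)
  then obtain d where d: "0 < d" "\<And>v. dist v w < d \<Longrightarrow> dist (maximiser c v) (maximiser c w) < e"
    by auto
  show "\<exists>d>0. \<forall>v. norm (v - w) < d \<longrightarrow> norm (Hcone c v - Hcone c w - maximiser c w \<bullet> (v - w)) \<le> e * norm (v - w)"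
  proof (intro exI[of _ d] conjI allI impI d(1))
    fix v assume "norm (v - w) < d"
    then have "norm (maximiser c v - maximiser c w) < e" using d(2)[of v] by (simp add: dist_norm)
    have "Hcone c v - Hcone c w - maximiser c w \<bullet> (v - w) \<ge> 0"
      using Hcone_ge[OF maximiser(1)[OF c, of w], of v] maximiser(2)[OF c, of w] by (simp add: inner_diff_right)
    moreover have "Hcone c v - Hcone c w - maximiser c w \<bullet> (v - w) \<le> (maximiser c v - maximiser c w) \<bullet> (v - w)"
      using Hcone_ge[OF maximiser(1)[OF c, of v], of w] maximiser(2)[OF c, of v] by (simp add: algebra_simps)
    moreover have "(maximiser c v - maximiser c w) \<bullet> (v - w) \<le> e * norm (v - w)"
      using norm_cauchy_schwarz[of "maximiser c v - maximiser c w" "v - w"]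
        \<open>norm (maximiser c v - maximiser c w) < e\<close>
      by (meson less_imp_le mult_right_mono norm_ge_zero order_trans)
    ultimately show "norm (Hcone c v - Hcone c w - maximiser c w \<bullet> (v - w)) \<le> e * norm (v - w)"
      by simp
  qed
qed

lemma esssup_H_le_iff:
  assumes w: "has_weak_gradient \<Omega> u (weak_gradient \<Omega> u)" and W: "open W" "W \<subseteq> \<Omega>"
  shows "esssup_H H \<Omega> u W \<le> ereal c \<longleftrightarrow> (AE z in lebesgue. z \<in> W \<longrightarrow> weak_gradient \<Omega> u z \<in> sublevel c)"
proof
  assume le: "esssup_H H \<Omega> u W \<le> ereal c"
  have "AE z in lebesgue_on W. ereal (H (weak_gradient \<Omega> u z)) \<le> esssup_H H \<Omega> u W"
    unfolding esssup_H_def by (rule esssup_AE)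
  then have "AE z in lebesgue_on W. weak_gradient \<Omega> u z \<in> sublevel c"
    by eventually_elim (use le in \<open>auto simp: sublevel_def dest: order_trans\<close>)
  then show "AE z in lebesgue. z \<in> W \<longrightarrow> weak_gradient \<Omega> u z \<in> sublevel c"
    by (simp add: AE_lebesgue_on_open[OF W(1)])
next
  assume ae: "AE z in lebesgue. z \<in> W \<longrightarrow> weak_gradient \<Omega> u z \<in> sublevel c"
  have "weak_gradient \<Omega> u \<in> borel_measurable (lebesgue_on W)"
    using w W by (intro locally_integrable_measurable) (auto simp: has_weak_gradient_def)
  moreover have "H \<in> borel_measurable borel"
    by (rule borel_measurable_continuous_onI[OF continuous_H])
  ultimately have "(\<lambda>z. H (weak_gradient \<Omega> u z)) \<in> borel_measurable (lebesgue_on W)"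
    by (rule measurable_compose)
  then show "esssup_H H \<Omega> u W \<le> ereal c"
    unfolding esssup_H_def using ae
    by (intro esssup_I) (auto simp: AE_lebesgue_on_open[OF W(1)] sublevel_def)
qed

end

section \<open>Comparison with cones\<close>

context segment_free_hamiltonian
begin

text \<open>For \<open>s = 1\<close> the cone with vertex \<open>(x0, a)\<close> lies above \<open>u\<close>, for \<open>s = - 1\<close> the reflected cone lies
below; treating both signs at once spares passing to the Hamiltonian \<open>p \<mapsto> H (- p)\<close>. Let
\<open>W\<close> be the set where the comparison fails. Minimality on \<open>W\<close>, with the cone as competitor,
yields \<open>H (Du) \<le> c\<close> there. The segment from a point \<open>z\<close> of \<open>W\<close> towards the vertex leaves \<open>W\<close>
through a boundary point, where the comparison holds. From there to \<open>z\<close> the cone changes by the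
largest amount compatible with the constraint, so the comparison holds at \<open>z\<close> too.\<close>

lemma comparison_with_cones:
  assumes \<Omega>: "open \<Omega>" and u: "u \<in> absolute_minimizers H \<Omega>"
    and V: "open V" "bounded V" "closure V \<subseteq> \<Omega>" and x0: "x0 \<notin> V"
    and s: "s = 1 \<or> s = (-1::real)" and c: "min_H \<le> c"
    and bd: "\<And>y. y \<in> frontier V \<Longrightarrow> s * (u y - a) \<le> Hcone c (s *\<^sub>R (y - x0))"
    and z: "z \<in> V"
  shows "s * (u z - a) \<le> Hcone c (s *\<^sub>R (z - x0))"
proof (rule ccontr)
  assume contra: "\<not> s * (u z - a) \<le> Hcone c (s *\<^sub>R (z - x0))"
  have ss: "s * s = 1" using s by auto
  note K = compact_sublevel[of c] sublevel_nonempty[OF c]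
  define v where "v y = a + s * Hcone c (s *\<^sub>R (y - x0))" for y
  define f where "f y = s * (u y - v y)" for y
  have f: "f y = s * (u y - a) - Hcone c (s *\<^sub>R (y - x0))" for y
  proof -
    have "f y = s * (u y - a) - (s * s) * Hcone c (s *\<^sub>R (y - x0))"
      unfolding f_def v_def by (simp only: algebra_simps)
    then show ?thesis by (simp add: ss)
  qed
  define W where "W = {y \<in> V. 0 < f y}"
  have zW: "z \<in> W" using z contra by (simp add: W_def f)
  have cu: "continuous_on \<Omega> u" and uW1: "u \<in> W1inf_loc \<Omega>"
    using u by (auto simp: absolute_minimizers_def)
  have cv: "continuous_on S v" for S
    unfolding v_def by (intro continuous_intros continuous_on_compose2[OF continuous_Hcone[OF c, of UNIV]]) auto
  have cf: "continuous_on \<Omega> f"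
    unfolding f_def using cu cv by (intro continuous_intros)
  have WV: "W \<subseteq> V" by (auto simp: W_def)
  have V\<Omega>: "V \<subseteq> \<Omega>" using V(3) closure_subset by blast
  have clW: "closure W \<subseteq> \<Omega>" using closure_mono[OF WV] V(3) by auto
  have W\<Omega>: "W \<subseteq> \<Omega>" using WV V\<Omega> by auto
  have oW: "open W"
  proof -
    have "open (V \<inter> f -` {0<..})"
      using V(1) V\<Omega> cf by (intro continuous_open_preimage) (auto intro: continuous_on_subset)
    also have "V \<inter> f -` {0<..} = W" by (auto simp: W_def)
    finally show ?thesis .
  qed
  have f_ge: "0 \<le> f y" if "y \<in> closure W" for y
    using continuous_ge_on_closure[OF continuous_on_subset[OF cf clW] that, of 0]
    by (auto simp: W_def intro: less_imp_le)
  have f_le: "f y \<le> 0" if "y \<in> closure W" "y \<notin> W" for y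
  proof (cases "y \<in> V")
    case False
    then have "y \<in> frontier V"
      using that(1) closure_mono[OF WV] V(1) by (auto simp: frontier_def interior_open)
    then show ?thesis using bd by (simp add: f)
  qed (use that in \<open>auto simp: W_def\<close>)
  have vu: "v y = u y" if "y \<in> frontier W" for y
  proof -
    have "f y = 0"
      using that f_ge[of y] f_le[of y] oW by (auto simp: frontier_def interior_open)
    then show ?thesis using s by (auto simp: f_def)
  qed
  \<comment> \<open>the gradient of the competitor; the two factors s from the chain rule cancel\<close>
  define G where "G y = maximiser c (s *\<^sub>R (y - x0))" for y
  have nz: "s *\<^sub>R (y - x0) \<noteq> 0" if "y \<in> W" for y
    using that WV x0 s by auto
  have der: "(v has_derivative (\<lambda>h. G y \<bullet> h)) (at y)" if "y \<in> W" for y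
  proof -
    have "((\<lambda>y. Hcone c (s *\<^sub>R (y - x0))) has_derivative (\<lambda>h. G y \<bullet> (s *\<^sub>R h))) (at y)"
      unfolding G_def
      by (rule has_derivative_compose[where g="Hcone c" and f="\<lambda>y. s *\<^sub>R (y - x0)",
            OF _ Hcone_has_derivative[OF c nz[OF that]]])
        (auto intro!: derivative_eq_intros)
    then have "(v has_derivative (\<lambda>h. 0 + s * (G y \<bullet> (s *\<^sub>R h)))) (at y)"
      unfolding v_def by (intro has_derivative_add has_derivative_const has_derivative_mult_right)
    moreover have "(\<lambda>h. 0 + s * (G y \<bullet> (s *\<^sub>R h))) = (\<lambda>h. G y \<bullet> h)"
      by (simp add: ss flip: mult.assoc)
    ultimately show ?thesis by simp
  qed
  have cG: "continuous_on W G"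
  proof -
    have "isCont G y" if "y \<in> W" for y
      unfolding G_def
      by (rule isCont_o2[where g="maximiser c" and f="\<lambda>y. s *\<^sub>R (y - x0)", OF _ isCont_maximiser[OF c nz[OF that]]])
        (auto intro!: continuous_intros)
    then show ?thesis by (simp add: continuous_at_imp_continuous_on)
  qed
  have wv: "has_weak_gradient W v G"
    by (rule has_weak_gradient_continuously_differentiable[OF oW der cG])
  have vW1: "v \<in> W1inf_loc W"
    using wv Linf_loc_continuous[OF oW cv] Linf_loc_continuous[OF oW cG] by (auto simp: W1inf_loc_def)
  have "esssup_H H \<Omega> u W \<le> esssup_H H W v W"
  proof -
    have "compact (closure W)" using bounded_subset[OF V(2) WV] by simp
    then show ?thesis
      using u oW clW vW1 cv vu unfolding absolute_minimizers_def by blast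
  qed
  also have "\<dots> \<le> ereal c"
  proof -
    have "v q - v p \<le> support_fun (sublevel c) (q - p)" for p q
      using s
    proof
      assume "s = 1"
      then show ?thesis
        using Hcone_diff_le[OF c, of "q - x0" "p - x0"] by (simp add: v_def Hcone_def)
    next
      assume "s = -1"
      then show ?thesis
        using Hcone_diff_le[OF c, of "x0 - p" "x0 - q"] by (simp add: v_def Hcone_def)
    qed
    with weak_gradient_mem_if_increments_le[OF has_weak_gradient_weak_gradient[OF vW1] oW order_refl cv _ K convex_sublevel]
    show ?thesis
      by (subst esssup_H_le_iff[OF has_weak_gradient_weak_gradient[OF vW1] oW order_refl]) blast
  qed
  finally have ae: "AE y in lebesgue. y \<in> W \<longrightarrow> weak_gradient \<Omega> u y \<in> sublevel c"
    by (simp add: esssup_H_le_iff[OF has_weak_gradient_weak_gradient[OF uW1] oW W\<Omega>])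
  \<comment> \<open>the ray from the vertex through z; t0 will be the last time at which it is outside W\<close>
  define q where "q t = x0 + t *\<^sub>R (z - x0)" for t :: real
  have cq: "continuous_on S q" for S unfolding q_def by (intro continuous_intros)
  have "compact ({0..1} \<inter> q -` (- W))"
  proof (rule compact_Int_closed[OF compact_Icc])
    show "closed (q -` (- W))"
      using oW cq[of UNIV]
      by (intro continuous_closed_vimage) (auto simp: continuous_on_eq_continuous_at)
  qed
  moreover have "0 \<in> {0..1} \<inter> q -` (- W)" using x0 WV by (auto simp: q_def)
  ultimately have "\<exists>t0\<in>{0..1} \<inter> q -` (- W). \<forall>t\<in>{0..1} \<inter> q -` (- W). t \<le> t0"
    by (intro compact_attains_sup) blast+
  then obtain t0 where t0: "t0 \<in> {0..1}" "q t0 \<notin> W" "\<And>t. t \<in> {0..1} \<Longrightarrow> q t \<notin> W \<Longrightarrow> t \<le> t0"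
    by auto
  have q1: "q 1 = z" by (simp add: q_def)
  have t01: "t0 < 1" using t0(1,2) q1 zW by (cases "t0 = 1") auto
  have inW: "q t \<in> W" if "t0 < t" "t \<le> 1" for t
    using t0(1) t0(3)[of t] that by force
  have clos: "{t0..1} = closure {t0<..<1}" using t01 by simp
  have q_cl: "q ` {t0..1} \<subseteq> closure W"
    unfolding clos
    by (rule image_closure_subset[OF cq closed_closure]) (use inW closure_subset in force)
  define M where "M = Hcone c (s *\<^sub>R (z - x0))"
  have step: "s * (u z - u (q t)) \<le> (1 - t) * M" if t: "t0 < t" "t < 1" for t
  proof -
    have seg: "closed_segment (q t) z \<subseteq> W"
    proof
      fix p assume "p \<in> closed_segment (q t) z"
      then obtain l where l: "0 \<le> l" "l \<le> 1" "p = (1 - l) *\<^sub>R q t + l *\<^sub>R z"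
        by (auto simp: closed_segment_def)
      have "p = q (t + l * (1 - t))" by (simp add: l q_def algebra_simps)
      moreover have "0 \<le> l * (1 - t)" "l * (1 - t) \<le> 1 - t"
        using l t mult_right_mono[of l 1 "1 - t"] by auto
      then have "t0 < t + l * (1 - t)" "t + l * (1 - t) \<le> 1" using t by linarith+
      ultimately show "p \<in> W" using inW by simp
    qed
    note inc = increment_le_support_fun[OF has_weak_gradient_weak_gradient[OF uW1] oW W\<Omega>
        continuous_on_subset[OF cu W\<Omega>] ae K, folded Hcone_def]
    have "s * (u z - u (q t)) \<le> Hcone c (s *\<^sub>R (z - q t))"
      using s
    proof
      assume "s = 1" then show ?thesis using inc[OF seg] by simp
    next
      assume "s = -1"
      then show ?thesis using inc[of z "q t"] seg by (simp add: closed_segment_commute)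
    qed
    also have "s *\<^sub>R (z - q t) = (1 - t) *\<^sub>R (s *\<^sub>R (z - x0))"
      by (simp add: q_def algebra_simps)
    also have "Hcone c \<dots> = (1 - t) * M"
      unfolding M_def using t by (intro Hcone_scale c) simp
    finally show ?thesis .
  qed
  have "s * (u z - u (q t0)) - (1 - t0) * M \<le> 0"
  proof (rule continuous_le_on_closure[where S="{t0<..<1}" and x=t0
        and f="\<lambda>t. s * (u z - u (q t)) - (1 - t) * M"])
    have "continuous_on (closure {t0<..<1}) (\<lambda>t. u (q t))"
      using q_cl clW clos by (intro continuous_on_compose2[OF cu cq]) auto
    then show "continuous_on (closure {t0<..<1}) (\<lambda>t. s * (u z - u (q t)) - (1 - t) * M)"
      by (intro continuous_intros)
    show "t0 \<in> closure {t0<..<1}" using clos t01 by auto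
  qed (use step in auto)
  moreover have "f (q t0) \<le> 0"
    using q_cl t01 by (intro f_le t0(2)) (auto simp: image_subset_iff)
  moreover have "Hcone c (s *\<^sub>R (q t0 - x0)) = t0 * M"
    using Hcone_scale[OF c, of t0 "s *\<^sub>R (z - x0)"] t0(1) by (simp add: q_def M_def mult.commute)
  ultimately have "s * (u z - a) \<le> M"
    by (simp add: f algebra_simps)
  with contra show False by (simp add: M_def)
qed

end

section \<open>The limiting energy at a point\<close>

locale minimizer_at_point = segment_free_hamiltonian H
  for H :: "'a::euclidean_space \<Rightarrow> real" +
  fixes \<Omega> :: "'a set" and u :: "'a \<Rightarrow> real" and x :: 'a and R :: real
  assumes open_\<Omega>: "open \<Omega>" and minimizer: "u \<in> absolute_minimizers H \<Omega>"
    and R_pos: "0 < R" and cball_subset: "cball x R \<subseteq> \<Omega>"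
begin

lemma W1inf: "u \<in> W1inf_loc \<Omega>" and continuous_u: "continuous_on \<Omega> u"
  using minimizer by (auto simp: absolute_minimizers_def)

lemmas weak_gradient_u = has_weak_gradient_weak_gradient[OF W1inf]

abbreviation energy :: "real \<Rightarrow> ereal" where
  "energy r \<equiv> esssup_H H \<Omega> u (ball x r)"

lemma ball_subset: "r \<le> R \<Longrightarrow> ball x r \<subseteq> \<Omega>"
  using cball_subset by force

lemma energy_le_iff:
  "r \<le> R \<Longrightarrow> energy r \<le> ereal c \<longleftrightarrow> (AE z in lebesgue. z \<in> ball x r \<longrightarrow> weak_gradient \<Omega> u z \<in> sublevel c)"
  by (rule esssup_H_le_iff[OF weak_gradient_u open_ball ball_subset])

lemma energy_mono:
  assumes "r \<le> s" "s \<le> R" shows "energy r \<le> energy s"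
proof (rule ereal_le_real)
  fix c assume "energy s \<le> ereal c"
  then have "AE z in lebesgue. z \<in> ball x s \<longrightarrow> weak_gradient \<Omega> u z \<in> sublevel c"
    using assms by (simp add: energy_le_iff)
  then have "AE z in lebesgue. z \<in> ball x r \<longrightarrow> weak_gradient \<Omega> u z \<in> sublevel c"
    by eventually_elim (use assms in auto)
  then show "energy r \<le> ereal c" using assms by (simp add: energy_le_iff)
qed

lemma energy_ge_min:
  assumes r: "0 < r" "r \<le> R" and c: "energy r \<le> ereal c" shows "min_H \<le> c"
proof (rule ccontr)
  assume "\<not> min_H \<le> c"
  then have "\<not> H p \<le> c" for p using order_trans[OF min_H_le[of p], of c] by blast
  then have "sublevel c = {}" by (simp add: sublevel_def)
  with c r have "AE z in lebesgue. z \<notin> ball x r" by (simp add: energy_le_iff)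
  then have "negligible (ball x r)"
    by (simp add: AE_iff_null_sets negligible_iff_null_sets)
  with r show False using open_not_negligible[OF open_ball, of x r] by auto
qed

text \<open>The locally bounded weak gradient from membership in \<open>W1inf_loc \<Omega>\<close> may differ from the
one chosen by \<open>weak_gradient\<close>; a bound is carried over from one to the other through the
increments of \<open>u\<close>.\<close>

lemma energy_finite: "\<exists>c. energy R \<le> ereal c"
proof -
  obtain g where g: "has_weak_gradient \<Omega> u g" "g \<in> Linf_loc \<Omega>"
    using W1inf by (auto simp: W1inf_loc_def)
  have "\<exists>B. AE z in lebesgue_on (cball x R). norm (g z) \<le> B"
    using g(2) cball_subset by (simp add: Linf_loc_def)
  then obtain B where "AE z in lebesgue_on (cball x R). norm (g z) \<le> B"
    by (elim exE)
  then have "AE z in lebesgue. z \<in> cball x R \<longrightarrow> norm (g z) \<le> B"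
    by (subst (asm) AE_restrict_space_iff) auto
  then have ae: "AE z in lebesgue. z \<in> ball x R \<longrightarrow> g z \<in> cball 0 (max 0 B)"
    by eventually_elim (auto simp: le_max_iff_disj)
  have sub: "ball x R \<subseteq> \<Omega>" by (rule ball_subset) simp
  note cu = continuous_on_subset[OF continuous_u sub]
  have ne: "cball (0::'a) (max 0 B) \<noteq> {}" by simp
  have "u z - u y \<le> support_fun (cball 0 (max 0 B)) (z - y)" if "y \<in> ball x R" "z \<in> ball x R" for y z
    by (rule increment_le_support_fun[OF g(1) open_ball sub cu ae compact_cball ne])
      (use that in \<open>intro closed_segment_subset convex_ball\<close>)
  from weak_gradient_mem_if_increments_le[OF weak_gradient_u open_ball sub cu this compact_cball ne convex_cball]
  have ae': "AE z in lebesgue. z \<in> ball x R \<longrightarrow> weak_gradient \<Omega> u z \<in> cball 0 (max 0 B)" .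
  obtain p where "\<forall>q\<in>cball 0 (max 0 B). H q \<le> H p"
    using continuous_attains_sup[OF compact_cball ne continuous_on_subset[OF continuous_H subset_UNIV]] by blast
  with ae' have "AE z in lebesgue. z \<in> ball x R \<longrightarrow> weak_gradient \<Omega> u z \<in> sublevel (H p)"
    by (auto simp: sublevel_def elim!: eventually_mono)
  then show ?thesis by (auto simp: energy_le_iff)
qed

text \<open>The limit of \<open>energy r\<close> as \<open>r\<close> tends to 0, as shown in \<open>energy_tendsto\<close>; defining it through
real upper bounds makes it a real number.\<close>

definition limit_level :: real where
  "limit_level = Inf {c. \<exists>r. 0 < r \<and> r \<le> R \<and> energy r \<le> ereal c}"

lemma limit_level_le: "0 < r \<Longrightarrow> r \<le> R \<Longrightarrow> energy r \<le> ereal c \<Longrightarrow> limit_level \<le> c"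
  unfolding limit_level_def
  by (rule cInf_lower) (blast, rule bdd_belowI[of _ min_H], blast intro: energy_ge_min)

lemma energy_le_above_limit_level:
  assumes "limit_level < c"
  obtains r where "0 < r" "r \<le> R" "energy r \<le> ereal c"
proof -
  have "{c. \<exists>r. 0 < r \<and> r \<le> R \<and> energy r \<le> ereal c} \<noteq> {}"
    using energy_finite R_pos by auto
  from cInf_lessD[OF this assms[unfolded limit_level_def]]
  obtain d r where "d < c" "0 < r" "r \<le> R" "energy r \<le> ereal d" by blast
  then show ?thesis
    using that[of r] by (meson ereal_less_eq(3) less_imp_le order_trans)
qed

lemma min_H_le_limit_level: "min_H \<le> limit_level"
  unfolding limit_level_def
  using energy_finite R_pos by (intro cInf_greatest) (auto intro: energy_ge_min)

lemma energy_tendsto: "(energy \<longlongrightarrow> ereal limit_level) (at_right 0)"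
proof (rule order_tendstoI)
  fix a assume a: "a < ereal limit_level"
  have "ereal limit_level \<le> energy r" if "0 < r" "r \<le> R" for r
    by (rule ereal_le_real) (use limit_level_le[OF that] in auto)
  then show "\<forall>\<^sub>F r in at_right 0. a < energy r"
    using a R_pos by (auto simp: eventually_at_right_field intro!: exI[of _ R] intro: less_le_trans)
next
  fix a assume "ereal limit_level < a"
  then obtain c where c: "ereal limit_level < ereal c" "ereal c < a"
    using ereal_dense2 by blast
  then obtain r where r: "0 < r" "r \<le> R" "energy r \<le> ereal c"
    by (auto intro: energy_le_above_limit_level)
  have "energy s < a" if "s < r" for s
    using energy_mono[of s r] r that c(2) by (meson le_less_trans less_imp_le order_trans)
  then show "\<forall>\<^sub>F r in at_right 0. energy r < a"
    using r(1) by (auto simp: eventually_at_right_field)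
qed

lemma increment_le_Hcone:
  assumes r: "0 < r" "r \<le> R" "energy r \<le> ereal c" and yz: "y \<in> ball x r" "z \<in> ball x r"
  shows "u z - u y \<le> Hcone c (z - y)"
  unfolding Hcone_def
proof (rule increment_le_support_fun[OF weak_gradient_u open_ball ball_subset])
  show "AE z in lebesgue. z \<in> ball x r \<longrightarrow> weak_gradient \<Omega> u z \<in> sublevel c"
    using r by (simp add: energy_le_iff)
  show "sublevel c \<noteq> {}"
    using energy_ge_min[OF r] by (rule sublevel_nonempty)
  show "closed_segment y z \<subseteq> ball x r"
    using yz by (intro closed_segment_subset convex_ball)
  show "continuous_on (ball x r) u"
    by (rule continuous_on_subset[OF continuous_u ball_subset[OF r(2)]])
qed (use r compact_sublevel in auto)

text \<open>If the bound by the cone of level \<open>limit_level\<close> were strict on the whole sphere, there would be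
room to lower the level to some \<open>l\<close> and to move the vertex to any \<open>x'\<close> near \<open>x\<close>. Comparison on
the punctured ball then bounds all increments near \<open>x\<close> by the cone of level \<open>l\<close>, so the energy
of a small ball is at most \<open>l\<close>, below its limit.\<close>

lemma touching_point:
  assumes level: "min_H < limit_level" and r: "0 < r" "r \<le> R" and s: "s = 1 \<or> s = (-1::real)"
  obtains y where "norm (y - x) = r" "Hcone limit_level (s *\<^sub>R (y - x)) \<le> s * (u y - u x)"
proof (rule ccontr)
  assume "\<not> thesis"
  with that have neg: "\<And>y. y \<in> sphere x r \<Longrightarrow> s * (u y - u x) < Hcone limit_level (s *\<^sub>R (y - x))"
    by (force simp: dist_norm norm_minus_commute not_le)
  let ?k = limit_level
  have k: "min_H \<le> ?k" using level by simp
  have abs_s: "\<bar>s\<bar> = 1" using s by auto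
  obtain B where B: "0 < B" "sublevel ?k \<subseteq> cball 0 B"
    by (rule compact_subset_cball[OF compact_sublevel])
  have cb: "cball x r \<subseteq> \<Omega>" using cball_subset r by auto
  define f where "f y = Hcone ?k (s *\<^sub>R (y - x)) - s * (u y - u x)" for y
  have "continuous_on (sphere x r) f"
    unfolding f_def using cb
    by (intro continuous_intros continuous_on_compose2[OF continuous_Hcone[OF k, of UNIV]]
        continuous_on_subset[OF continuous_u]) auto
  then obtain e where e: "0 < e" "\<And>y. y \<in> sphere x r \<Longrightarrow> e \<le> f y"
  proof -
    have "sphere x r \<noteq> {}" using r by simp
    from continuous_attains_inf[OF compact_sphere this \<open>continuous_on (sphere x r) f\<close>]
    obtain y0 where "y0 \<in> sphere x r" "\<forall>y\<in>sphere x r. f y0 \<le> f y" by blast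
    then show ?thesis using neg[of y0] by (intro that[of "f y0"]) (auto simp: f_def)
  qed
  \<comment> \<open>mixing with the minimiser of H lowers the level, and costs at most t * 2 * B * r on the sphere\<close>
  define t where "t = min (1/2) (e / (8 * B * r))"
  have t: "0 < t" "t < 1" "t * (2 * B * r) \<le> e / 4"
    using e(1) B(1) r(1) by (auto simp: t_def min_def field_simps)
  define l where "l = (1 - t) * ?k + t * min_H"
  have l: "min_H \<le> l" "l < ?k"
  proof -
    have "l - min_H = (1 - t) * (?k - min_H)" by (simp add: l_def algebra_simps)
    moreover have "0 \<le> (1 - t) * (?k - min_H)" using t level by simp
    ultimately show "min_H \<le> l" by simp
    have "?k - l = t * (?k - min_H)" by (simp add: l_def algebra_simps)
    moreover have "0 < t * (?k - min_H)" using t level by simp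
    ultimately show "l < ?k" by simp
  qed
  have lower: "Hcone ?k w - t * (2 * B * norm w) \<le> Hcone l w" for w
  proof -
    define p where "p = maximiser ?k w"
    have p: "H p \<le> ?k" "p \<bullet> w = Hcone ?k w" using maximiser[OF k] by (auto simp: p_def)
    have "H ((1 - t) *\<^sub>R p + t *\<^sub>R argmin_H) \<le> (1 - t) * H p + t * min_H"
      using convex_onD[OF convex_H] t by auto
    also have "\<dots> \<le> l" unfolding l_def using p(1) t by (auto intro!: mult_left_mono)
    finally have "((1 - t) *\<^sub>R p + t *\<^sub>R argmin_H) \<bullet> w \<le> Hcone l w" by (rule Hcone_ge)
    moreover have "((1 - t) *\<^sub>R p + t *\<^sub>R argmin_H) \<bullet> w = Hcone ?k w - t * ((p - argmin_H) \<bullet> w)"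
      by (simp add: p(2) inner_add_left inner_diff_left algebra_simps)
    moreover have "t * ((p - argmin_H) \<bullet> w) \<le> t * (2 * B * norm w)"
    proof (rule mult_left_mono)
      have "p \<in> cball 0 B" "argmin_H \<in> cball 0 B" using B(2) p(1) k by (auto simp: sublevel_def)
      then have "norm (p - argmin_H) \<le> 2 * B" using norm_triangle_ineq4[of p argmin_H] by simp
      then have "norm (p - argmin_H) * norm w \<le> 2 * B * norm w" by (intro mult_right_mono) auto
      then show "(p - argmin_H) \<bullet> w \<le> 2 * B * norm w"
        using norm_cauchy_schwarz[of "p - argmin_H" w] by linarith
    qed (use t in simp)
    ultimately show ?thesis by simp
  qed
  have lip: "Hcone l v - Hcone l w \<le> B * norm (v - w)" for v w
  proof -
    have "sublevel l \<subseteq> cball 0 B"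
      using sublevel_mono[of l ?k] l(2) B(2) by (meson less_imp_le order_trans)
    from support_fun_lipschitz[OF compact_sublevel sublevel_nonempty[OF l(1)] this, of v w]
    show ?thesis unfolding Hcone_def by linarith
  qed
  have "x \<in> \<Omega>" using cball_subset R_pos by auto
  then have "isCont u x"
    using continuous_u open_\<Omega> continuous_on_eq_continuous_at by blast
  then have "\<exists>d>0. \<forall>x'. dist x' x < d \<longrightarrow> dist (u x') (u x) < e / 4"
    unfolding continuous_at_eps_delta using e(1) by (elim allE[of _ "e / 4"]) simp
  then obtain d1 where d1: "0 < d1" "\<And>x'. dist x' x < d1 \<Longrightarrow> \<bar>u x' - u x\<bar> < e / 4"
    by (auto simp: dist_real_def)
  \<comment> \<open>a displacement of the vertex by d changes both u and the cone by at most e / 4\<close>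
  define d where "d = min d1 (min r (e / (4 * B)))"
  have "d \<le> e / (4 * B)" by (simp add: d_def)
  then have "d * (4 * B) \<le> e" using B(1) by (simp add: pos_le_divide_eq)
  moreover have "0 < d" "d \<le> d1" "d \<le> r"
    using d1(1) r(1) e(1) B(1) by (auto simp: d_def)
  ultimately have d: "0 < d" "d \<le> d1" "d \<le> r" "B * d \<le> e / 4"
    by (auto simp: algebra_simps)
  have cmp: "s * (u z - u x') \<le> Hcone l (s *\<^sub>R (z - x'))" if x': "x' \<in> ball x d" and z: "z \<in> ball x r" for x' z
  proof (cases "z = x'")
    case True
    then show ?thesis using Hcone_zero[OF l(1)] by simp
  next
    case False
    show ?thesis
    proof (rule comparison_with_cones[OF open_\<Omega> minimizer, of "ball x r - {x'}"])
      have "closure (ball x r - {x'}) \<subseteq> cball x r"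
        by (rule closure_minimal) auto
      then show "closure (ball x r - {x'}) \<subseteq> \<Omega>" using cb by blast
      fix y assume y: "y \<in> frontier (ball x r - {x'})"
      have "y \<in> cball x r" "y \<notin> ball x r - {x'}"
        using y \<open>closure (ball x r - {x'}) \<subseteq> cball x r\<close> interior_open[OF open_delete[OF open_ball, of x r x']]
        by (auto simp: frontier_def)
      then consider "y = x'" | "y \<in> sphere x r" by force
      then show "s * (u y - u x') \<le> Hcone l (s *\<^sub>R (y - x'))"
      proof cases
        case 1
        then show ?thesis using Hcone_zero[OF l(1)] by simp
      next
        case 2
        have "s * (u y - u x') = s * (u y - u x) + s * (u x - u x')" by (simp add: algebra_simps)
        also have "s * (u x - u x') \<le> e / 4"
        proof -
          have "s * (u x - u x') \<le> \<bar>s * (u x - u x')\<bar>" by simp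
          also have "\<dots> = \<bar>u x' - u x\<bar>" by (simp add: abs_mult abs_s)
          also have "\<dots> \<le> e / 4" using d1(2)[of x'] x' d(2) by (simp add: dist_commute)
          finally show ?thesis .
        qed
        also have "s * (u y - u x) \<le> Hcone ?k (s *\<^sub>R (y - x)) - e"
          using e(2)[OF 2] by (simp add: f_def)
        also have "Hcone ?k (s *\<^sub>R (y - x)) \<le> Hcone l (s *\<^sub>R (y - x)) + e / 4"
          using lower[of "s *\<^sub>R (y - x)"] t(3) 2 by (simp add: abs_s dist_norm norm_minus_commute)
        also have "Hcone l (s *\<^sub>R (y - x)) \<le> Hcone l (s *\<^sub>R (y - x')) + e / 4"
        proof -
          have "norm (s *\<^sub>R (y - x) - s *\<^sub>R (y - x')) = norm (x' - x)"
            by (simp add: abs_s flip: scaleR_diff_right)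
          also have "\<dots> \<le> d" using x' by (simp add: dist_norm norm_minus_commute)
          finally have "B * norm (s *\<^sub>R (y - x) - s *\<^sub>R (y - x')) \<le> e / 4"
            using d(4) B(1) by (meson less_imp_le mult_left_mono order_trans)
          then show ?thesis using lip[of "s *\<^sub>R (y - x)" "s *\<^sub>R (y - x')"] by linarith
        qed
        finally show ?thesis using e(1) by simp
      qed
    qed (use s l z False in auto)
  qed
  have "energy d \<le> ereal l"
  proof -
    have sub: "ball x d \<subseteq> \<Omega>" using d r by (intro ball_subset) auto
    have "u z - u y \<le> support_fun (sublevel l) (z - y)" if yz: "y \<in> ball x d" "z \<in> ball x d" for y z
      using s
    proof
      assume "s = 1"
      then show ?thesis using cmp[of y z] yz d(3) by (simp add: Hcone_def)
    next
      assume "s = -1"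
      then show ?thesis using cmp[of z y] yz d(3) by (simp add: Hcone_def)
    qed
    from weak_gradient_mem_if_increments_le[OF weak_gradient_u open_ball sub continuous_on_subset[OF continuous_u sub]
        this compact_sublevel sublevel_nonempty[OF l(1)] convex_sublevel]
    show ?thesis using d r by (simp add: energy_le_iff)
  qed
  then have "?k \<le> l" using d r by (intro limit_level_le[of d]) auto
  with l show False by simp
qed

end

section \<open>Linear approximation at small scales\<close>

context segment_free_hamiltonian
begin

text \<open>By compactness the sublevel sets slightly above \<open>k\<close> lie in the \<open>e\<close>-neighbourhood of the one at
level \<open>k\<close>.\<close>

lemma Hcone_right_continuous:
  assumes k: "min_H \<le> k" and e: "0 < e"
  obtains c where "k < c" "\<And>w. Hcone c w \<le> Hcone k w + e * norm w"
proof -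
  let ?S = "sublevel (k + 1) \<inter> {p. e \<le> infdist p (sublevel k)}"
  have "compact ?S"
    by (intro compact_Int_closed compact_sublevel closed_Collect_le continuous_intros)
  have "\<exists>c>k. \<forall>p\<in>sublevel c. infdist p (sublevel k) < e"
  proof (cases "?S = {}")
    case True
    then show ?thesis by (intro exI[of _ "k + 1"]) (auto simp: not_le)
  next
    case False
    obtain p where p: "p \<in> ?S" "\<forall>q\<in>?S. H p \<le> H q"
      using continuous_attains_inf[OF \<open>compact ?S\<close> False continuous_on_subset[OF continuous_H subset_UNIV]]
      by blast
    have "k < H p"
    proof (rule ccontr)
      assume "\<not> k < H p"
      then have "infdist p (sublevel k) = 0" by (simp add: sublevel_def)
      with p(1) e show False by simp
    qed
    define c where "c = min (k + 1) ((k + H p) / 2)"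
    have c: "k < c" "c < H p" "c \<le> k + 1"
      using \<open>k < H p\<close> by (auto simp: c_def min_def field_simps)
    have "infdist q (sublevel k) < e" if q: "q \<in> sublevel c" for q
    proof (rule ccontr)
      assume "\<not> infdist q (sublevel k) < e"
      with q c(3) have "q \<in> ?S" by (auto simp: sublevel_def)
      with p(2) have "H p \<le> H q" by blast
      with q c(2) show False by (simp add: sublevel_def)
    qed
    with c(1) show ?thesis by auto
  qed
  then obtain c where c: "k < c" "\<forall>p\<in>sublevel c. infdist p (sublevel k) < e" by blast
  have "Hcone c w \<le> Hcone k w + e * norm w" for w
  proof -
    have kc: "min_H \<le> c" using k c(1) by simp
    define q where "q = maximiser c w"
    have q: "q \<in> sublevel c" "q \<bullet> w = Hcone c w"
      using maximiser[OF kc] by (auto simp: q_def sublevel_def)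
    obtain p where p: "p \<in> sublevel k" "infdist q (sublevel k) = dist q p"
      using infdist_attains_inf[OF closed_sublevel sublevel_nonempty[OF k]] by blast
    have "norm (q - p) \<le> e" using c(2) q(1) p(2) by (auto simp: dist_norm less_imp_le)
    have "Hcone c w = p \<bullet> w + (q - p) \<bullet> w" by (simp add: inner_diff_left q(2))
    also have "p \<bullet> w \<le> Hcone k w" using p(1) by (intro Hcone_ge) (simp add: sublevel_def)
    also have "(q - p) \<bullet> w \<le> norm (q - p) * norm w" by (rule norm_cauchy_schwarz)
    also have "\<dots> \<le> e * norm w" using \<open>norm (q - p) \<le> e\<close> by (rule mult_right_mono) simp
    finally show ?thesis by simp
  qed
  with c(1) show ?thesis by (rule that)
qed

text \<open>The maximiser depends only on the direction of its argument, and a bounded perturbation hardly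
changes the direction of a long vector. This is the sense in which a cone looks flat far away
from its vertex.\<close>

lemma maximiser_far_away:
  assumes k: "min_H \<le> k" and e: "0 < e"
  obtains N where "2 \<le> N" "\<And>b w. norm b = N \<Longrightarrow> norm w \<le> 1 \<Longrightarrow> norm (maximiser k (b + w) - maximiser k b) \<le> e"
proof -
  let ?A = "cball (0::'a) 2 - ball 0 (1/2)"
  have "uniformly_continuous_on ?A (maximiser k)"
    by (intro compact_uniformly_continuous continuous_at_imp_continuous_on ballI isCont_maximiser k compact_diff)
      auto
  then obtain d where d: "0 < d" "\<And>v w. v \<in> ?A \<Longrightarrow> w \<in> ?A \<Longrightarrow> dist w v < d \<Longrightarrow>
      dist (maximiser k w) (maximiser k v) < e"
    using e unfolding uniformly_continuous_on_def by blast
  \<comment> \<open>the perturbed vector, divided by N, stays in the annulus and moves by at most 1 / N\<close>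
  define N where "N = max 2 (2 / d)"
  have N: "2 \<le> N" "1 / N < d"
    using d(1) by (auto simp: N_def max_def field_simps)
  have "norm (maximiser k (b + w) - maximiser k b) \<le> e" if b: "norm b = N" and w: "norm w \<le> 1" for b w
  proof -
    have nb: "N - 1 \<le> norm (b + w)" "norm (b + w) \<le> N + 1"
      using norm_triangle_ineq[of b w] norm_diff_ineq[of b w] b w by linarith+
    have n0: "b + w \<noteq> 0" "b \<noteq> 0" using nb b N(1) by auto
    have eqs: "norm ((1/N) *\<^sub>R (b + w)) = norm (b + w) / N" "norm ((1/N) *\<^sub>R b) = 1"
      using b N(1) by simp_all
    have "1/2 \<le> norm (b + w) / N" "norm (b + w) / N \<le> 2"
      using nb N(1) by (simp_all add: field_simps)
    then have "(1/N) *\<^sub>R (b + w) \<in> ?A" "(1/N) *\<^sub>R b \<in> ?A"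
      unfolding Diff_iff mem_cball_0 mem_ball_0 eqs by simp_all
    moreover have "dist ((1/N) *\<^sub>R (b + w)) ((1/N) *\<^sub>R b) < d"
    proof -
      have "dist ((1/N) *\<^sub>R (b + w)) ((1/N) *\<^sub>R b) = norm w / N"
        using N(1) by (simp add: dist_norm flip: scaleR_diff_right)
      also have "\<dots> \<le> 1 / N" using w N(1) by (intro divide_right_mono) auto
      finally show ?thesis using N(2) by simp
    qed
    ultimately have "dist (maximiser k ((1/N) *\<^sub>R (b + w))) (maximiser k ((1/N) *\<^sub>R b)) < e"
      by (intro d(2))
    then show ?thesis
      using maximiser_scale[OF k _ n0(1), of "1/N"] maximiser_scale[OF k _ n0(2), of "1/N"] N(1)
      by (simp add: dist_norm)
  qed
  with N(1) show ?thesis by (rule that)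
qed

text \<open>Exact additivity \<open>C a + C b = C (a + b)\<close> forces a maximiser for \<open>a + b\<close> to be one for \<open>a\<close> and
for \<open>b\<close>; compactness of the sphere makes this quantitative.\<close>

lemma Hcone_almost_additive:
  assumes k: "min_H \<le> k" and e: "0 < e" and N: "0 < N"
  obtains d where "0 < d" "\<And>a b. norm a = N \<Longrightarrow> norm b = N \<Longrightarrow>
    Hcone k a + Hcone k b \<le> Hcone k (a + b) + d \<Longrightarrow> norm (maximiser k a - maximiser k b) \<le> e"
proof -
  let ?Q = "sphere (0::'a) N \<times> sphere (0::'a) N"
  let ?P = "\<lambda>z. norm (maximiser k (fst z) - maximiser k (snd z))"
  define F where "F = (\<lambda>z. Hcone k (fst z) + Hcone k (snd z) - Hcone k (fst z + snd z))"
  define S where "S = ?Q \<inter> ?P -` {e..}"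
  have cP: "continuous_on (sphere 0 N) (maximiser k)"
    using N by (intro continuous_at_imp_continuous_on ballI isCont_maximiser k) auto
  have "continuous_on ?Q ?P"
    by (intro continuous_intros continuous_on_compose2[OF cP]) auto
  then have "closed S"
    unfolding S_def by (rule continuous_closed_preimage) (auto intro: closed_Times)
  moreover have "bounded S"
    by (rule bounded_subset[OF compact_imp_bounded[OF compact_Times[OF compact_sphere compact_sphere]]])
      (auto simp: S_def)
  ultimately have "compact S" by (simp add: compact_eq_bounded_closed)
  have cF: "continuous_on S F"
    unfolding F_def by (intro continuous_intros continuous_on_compose2[OF continuous_Hcone[OF k, of UNIV]]) auto
  have pos: "0 < F z" if "z \<in> S" for z
  proof (rule ccontr)
    obtain a b where z: "z = (a, b)" by (cases z)
    have ab: "a \<noteq> 0" "b \<noteq> 0" "e \<le> norm (maximiser k a - maximiser k b)"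
      using that N by (auto simp: S_def z)
    assume "\<not> 0 < F z"
    then have le: "Hcone k a + Hcone k b \<le> Hcone k (a + b)" by (simp add: z F_def)
    define p where "p = maximiser k (a + b)"
    have p: "H p \<le> k" "p \<bullet> a + p \<bullet> b = Hcone k (a + b)"
      using maximiser[OF k, of "a + b"] by (auto simp: p_def inner_add_right)
    have "p \<bullet> a \<le> Hcone k a" "p \<bullet> b \<le> Hcone k b" using p(1) by (auto intro: Hcone_ge)
    with le p(2) have "p \<bullet> a = Hcone k a" "p \<bullet> b = Hcone k b" by linarith+
    then have "maximiser k a = p" "maximiser k b = p"
      using p(1) ab k by (auto intro: maximiser_eqI)
    then show False using ab(3) e by simp
  qed
  have "\<exists>d>0. \<forall>z\<in>S. d < F z"
  proof (cases "S = {}")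
    case False
    from continuous_attains_inf[OF \<open>compact S\<close> False cF]
    obtain z0 where z0: "z0 \<in> S" "\<forall>z\<in>S. F z0 \<le> F z" by blast
    have h: "0 < F z0 / 2" using pos[OF z0(1)] by simp
    have "\<forall>z\<in>S. F z0 / 2 < F z"
    proof
      fix z assume "z \<in> S"
      with z0(2) have "F z0 \<le> F z" by blast
      with h show "F z0 / 2 < F z" by linarith
    qed
    with h show ?thesis by blast
  qed (auto intro: exI[of _ 1])
  then obtain d where d: "0 < d" "\<forall>z\<in>S. d < F z" by blast
  have "norm (maximiser k a - maximiser k b) \<le> e"
    if "norm a = N" "norm b = N" "Hcone k a + Hcone k b \<le> Hcone k (a + b) + d" for a b
  proof (rule ccontr)
    assume "\<not> norm (maximiser k a - maximiser k b) \<le> e"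
    with that have "(a, b) \<in> S" by (auto simp: S_def)
    with d(2) have "d < F (a, b)" by blast
    with that(3) show False by (simp add: F_def)
  qed
  with d(1) show ?thesis by (rule that)
qed

end

context minimizer_at_point
begin

definition difference_quotient :: "real \<Rightarrow> 'a \<Rightarrow> real" where
  "difference_quotient r w = (u (x + r *\<^sub>R w) - u x) / r"

lemma difference_quotient_increment:
  assumes s: "0 < s" "s \<le> R" "energy s \<le> ereal c" and r: "0 < r" "r * norm v < s" "r * norm w < s"
  shows "difference_quotient r v - difference_quotient r w \<le> Hcone c (v - w)"
proof -
  have c: "min_H \<le> c" by (rule energy_ge_min[OF s])
  have "u (x + r *\<^sub>R v) - u (x + r *\<^sub>R w) \<le> Hcone c ((x + r *\<^sub>R v) - (x + r *\<^sub>R w))"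
    using r by (intro increment_le_Hcone[OF s]) (auto simp: dist_norm)
  also have "(x + r *\<^sub>R v) - (x + r *\<^sub>R w) = r *\<^sub>R (v - w)" by (simp add: algebra_simps)
  also have "Hcone c \<dots> = r * Hcone c (v - w)" using r c by (intro Hcone_scale) auto
  finally have "u (x + r *\<^sub>R v) - u (x + r *\<^sub>R w) \<le> r * Hcone c (v - w)" .
  then show ?thesis
    using r(1) by (simp add: difference_quotient_def pos_divide_le_eq mult.commute flip: diff_divide_distrib)
qed

text \<open>The touching point on the sphere of radius \<open>r * N\<close>, seen at scale \<open>r\<close>. For \<open>s = - 1\<close> it is \<open>- a\<close>
and \<open>u\<close> descends towards it.\<close>

lemma difference_quotient_touching:
  assumes "min_H < limit_level" "0 < r" "0 < N" "r * N \<le> R" "s = 1 \<or> s = (-1::real)"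
  obtains a where "norm a = N" "Hcone limit_level a \<le> s * difference_quotient r (s *\<^sub>R a)"
proof -
  have "0 < r * N" using assms by simp
  from touching_point[OF assms(1) this assms(4,5)]
  obtain y where y: "norm (y - x) = r * N" "Hcone limit_level (s *\<^sub>R (y - x)) \<le> s * (u y - u x)" .
  define a where "a = (s / r) *\<^sub>R (y - x)"
  have ss: "s * s = 1" "\<bar>s\<bar> = 1" using assms(5) by auto
  have "norm a = N" using y(1) assms(2,3) ss by (simp add: a_def abs_mult)
  moreover have "x + r *\<^sub>R (s *\<^sub>R a) = y"
    using assms(2) ss(1) by (simp add: a_def)
  moreover have "Hcone limit_level a = Hcone limit_level (s *\<^sub>R (y - x)) / r"
    using Hcone_scale[of limit_level "1 / r" "s *\<^sub>R (y - x)"] assms(1,2) by (simp add: a_def)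
  ultimately show ?thesis
    using y(2) assms(2) by (intro that[of a]) (auto simp: difference_quotient_def divide_right_mono)
qed

text \<open>Let \<open>a\<close> and \<open>- b\<close> be the touching points at distance \<open>N\<close>. The increments from \<open>- b\<close> to \<open>w\<close> and
from \<open>w\<close> to \<open>a\<close> are bounded by the cone, whose change under the bounded displacement \<open>w\<close> is
nearly linear because \<open>N\<close> is large; the two slopes nearly agree by almost-additivity at \<open>a\<close> and
\<open>b\<close>. At the lowest level the only available slope is \<open>argmin_H\<close>, and increments from and to the
centre suffice.\<close>

lemma nearly_linear_at_small_scales:
  assumes e: "0 < e"
  shows "\<exists>r0>0. \<forall>r. 0 < r \<longrightarrow> r < r0 \<longrightarrow>
    (\<exists>p. H p = limit_level \<and> (\<forall>w. norm w \<le> 1 \<longrightarrow> \<bar>difference_quotient r w - p \<bullet> w\<bar> \<le> e))"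
proof (cases "limit_level = min_H")
  case True
  let ?k = limit_level
  have k: "min_H \<le> ?k" by (rule min_H_le_limit_level)
  obtain c where c: "?k < c" "\<And>w. Hcone c w \<le> Hcone ?k w + e * norm w"
    by (rule Hcone_right_continuous[OF k e]) blast
  obtain s where s: "0 < s" "s \<le> R" "energy s \<le> ereal c"
    by (rule energy_le_above_limit_level[OF c(1)])
  have lin: "Hcone ?k w = argmin_H \<bullet> w" for w
  proof -
    have "maximiser ?k w \<in> sublevel min_H" using maximiser(1)[OF k, of w] True by (simp add: sublevel_def)
    then show ?thesis using maximiser(2)[OF k, of w] sublevel_min_H by simp
  qed
  show ?thesis
  proof (intro exI[of _ s] conjI allI impI s(1))
    fix r assume r: "0 < r" "r < s"
    have "\<bar>difference_quotient r w - argmin_H \<bullet> w\<bar> \<le> e" if w: "norm w \<le> 1" for w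
    proof -
      have rw: "r * norm w < s" using mult_left_mono[OF w, of r] r by linarith
      have q0: "difference_quotient r 0 = 0" by (simp add: difference_quotient_def)
      have en: "e * norm w \<le> e" using w e by (simp add: mult_left_le)
      have "difference_quotient r w - difference_quotient r 0 \<le> Hcone c (w - 0)"
        using rw r s(1) by (intro difference_quotient_increment[OF s]) auto
      then have "difference_quotient r w \<le> argmin_H \<bullet> w + e"
        using c(2)[of w] lin[of w] en q0 by simp
      moreover have "difference_quotient r 0 - difference_quotient r w \<le> Hcone c (0 - w)"
        using rw r s(1) by (intro difference_quotient_increment[OF s]) auto
      then have "- difference_quotient r w \<le> - (argmin_H \<bullet> w) + e"
        using c(2)[of "- w"] lin[of "- w"] en q0 by simp
      ultimately show ?thesis by linarith
    qed
    with True show "\<exists>p. H p = ?k \<and> (\<forall>w. norm w \<le> 1 \<longrightarrow> \<bar>difference_quotient r w - p \<bullet> w\<bar> \<le> e)"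
      by (intro exI[of _ argmin_H]) simp
  qed
next
  case False
  let ?k = limit_level
  let ?P = "maximiser ?k"
  have k: "min_H \<le> ?k" by (rule min_H_le_limit_level)
  with False have less: "min_H < ?k" by simp
  obtain N where N: "2 \<le> N"
    "\<And>b w. norm b = N \<Longrightarrow> norm w \<le> 1 \<Longrightarrow> norm (?P (b + w) - ?P b) \<le> e / 4"
    using maximiser_far_away[OF k, of "e / 4"] e by auto
  obtain d where d: "0 < d" "\<And>a b. norm a = N \<Longrightarrow> norm b = N \<Longrightarrow>
    Hcone ?k a + Hcone ?k b \<le> Hcone ?k (a + b) + d \<Longrightarrow> norm (?P a - ?P b) \<le> e / 4"
    using Hcone_almost_additive[OF k, of "e / 4" N] e N(1) by auto
  \<comment> \<open>the loss e' per unit length must stay below d over the length 2 * N and below e / 4 over N + 1\<close>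
  define e' where "e' = min (d / (2 * N)) (e / (4 * (N + 1)))"
  have "e' \<le> d / (2 * N)" "e' \<le> e / (4 * (N + 1))" by (simp_all add: e'_def)
  then have "e' * (2 * N) \<le> d" "e' * (4 * (N + 1)) \<le> e"
    using N(1) pos_le_divide_eq[of "2 * N" e' d] pos_le_divide_eq[of "4 * (N + 1)" e' e] by auto
  moreover have "0 < e'" using d(1) e N(1) by (simp add: e'_def)
  ultimately have e': "0 < e'" "e' * (2 * N) \<le> d" "e' * (N + 1) \<le> e / 4"
    by (auto simp: algebra_simps)
  obtain c where c: "?k < c" "\<And>w. Hcone c w \<le> Hcone ?k w + e' * norm w"
    by (rule Hcone_right_continuous[OF k e'(1)]) blast
  obtain s where s: "0 < s" "s \<le> R" "energy s \<le> ereal c"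
    by (rule energy_le_above_limit_level[OF c(1)])
  show ?thesis
  proof (intro exI[of _ "s / (N + 1)"] conjI allI impI)
    show "0 < s / (N + 1)" using s N by simp
    fix r assume r: "0 < r" "r < s / (N + 1)"
    have rN1: "r * (N + 1) < s" using r(2) N(1) by (simp add: pos_less_divide_eq)
    have rN: "r * N < s" using rN1 r(1) by (simp add: algebra_simps)
    have r1: "r * norm w < s" if "norm w \<le> 1" for w :: 'a
      using mult_left_mono[OF that, of r] rN1 r(1) N(1) mult_left_mono[of 1 "N + 1" r] by linarith
    have N0: "0 < N" using N(1) by simp
    obtain a where a: "norm a = N" "Hcone ?k a \<le> difference_quotient r a"
      using difference_quotient_touching[OF less r(1) N0, of 1] rN s(2) by auto
    obtain b where b: "norm b = N" "Hcone ?k b \<le> - difference_quotient r (- b)"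
      using difference_quotient_touching[OF less r(1) N0, of "-1"] rN s(2) by auto
    \<comment> \<open>the climb from - b to a is bounded by the cone in direction a + b\<close>
    have "Hcone ?k a + Hcone ?k b \<le> difference_quotient r a - difference_quotient r (- b)" using a b by simp
    also have "\<dots> \<le> Hcone c (a - (- b))"
      using a(1) b(1) rN r(1) by (intro difference_quotient_increment[OF s]) auto
    also have "\<dots> \<le> Hcone ?k (a + b) + e' * norm (a + b)" using c(2)[of "a + b"] by simp
    also have "e' * norm (a + b) \<le> e' * (2 * N)"
      using norm_triangle_ineq[of a b] a(1) b(1) e'(1) by (intro mult_left_mono) auto
    finally have "Hcone ?k a + Hcone ?k b \<le> Hcone ?k (a + b) + d" using e'(2) by simp
    then have Pab: "norm (?P a - ?P b) \<le> e / 4" by (rule d(2)[OF a(1) b(1)])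
    define p where "p = ?P a"
    have inner_small: "q \<bullet> w \<le> f" if "norm q \<le> f" "norm w \<le> 1" for q w :: 'a and f
    proof -
      have "q \<bullet> w \<le> norm q * norm w" by (rule norm_cauchy_schwarz)
      also have "\<dots> \<le> norm q * 1" using that(2) by (rule mult_left_mono) simp
      finally show ?thesis using that(1) by simp
    qed
    have "\<bar>difference_quotient r w - p \<bullet> w\<bar> \<le> e" if w: "norm w \<le> 1" for w
    proof -
      have en: "e' * norm v \<le> e / 4" if "norm v \<le> N + 1" for v :: 'a
        using mult_left_mono[OF that, of e'] e' by linarith
      \<comment> \<open>upper bound: climb from - b to w\<close>
      have "difference_quotient r w - difference_quotient r (- b) \<le> Hcone c (w - (- b))"
        using b(1) rN r(1) r1[OF w] by (intro difference_quotient_increment[OF s]) auto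
      also have "\<dots> \<le> Hcone ?k (b + w) + e / 4"
        using c(2)[of "b + w"] en[of "b + w"] norm_triangle_ineq[of b w] b(1) w
        by (simp add: add.commute)
      also have "Hcone ?k (b + w) = ?P (b + w) \<bullet> b + ?P (b + w) \<bullet> w"
        using maximiser(2)[OF k, of "b + w"] by (simp add: inner_add_right)
      also have "?P (b + w) \<bullet> b \<le> Hcone ?k b" by (rule Hcone_ge[OF maximiser(1)[OF k]])
      finally have "difference_quotient r w \<le> ?P (b + w) \<bullet> w + e / 4" using b(2) by simp
      moreover have "(?P (b + w) - ?P b) \<bullet> w \<le> e / 4" by (rule inner_small[OF N(2)[OF b(1) w] w])
      moreover have "(?P b - ?P a) \<bullet> w \<le> e / 4"
        using Pab by (intro inner_small w) (simp add: norm_minus_commute)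
      ultimately have up: "difference_quotient r w \<le> p \<bullet> w + e"
        using e by (simp add: p_def inner_diff_left)
      have nw: "norm (- w) \<le> 1" using w by simp
      \<comment> \<open>lower bound: climb from w to a\<close>
      have "difference_quotient r a - difference_quotient r w \<le> Hcone c (a - w)"
        using a(1) rN r(1) r1[OF w] by (intro difference_quotient_increment[OF s]) auto
      also have "\<dots> \<le> Hcone ?k (a - w) + e / 4"
        using c(2)[of "a - w"] en[of "a - w"] norm_triangle_ineq4[of a w] a(1) w by simp
      also have "Hcone ?k (a - w) = ?P (a - w) \<bullet> a + ?P (a - w) \<bullet> (- w)"
        using maximiser(2)[OF k, of "a - w"] by (simp add: inner_diff_right)
      also have "?P (a - w) \<bullet> a \<le> Hcone ?k a" by (rule Hcone_ge[OF maximiser(1)[OF k]])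
      finally have "- difference_quotient r w \<le> ?P (a - w) \<bullet> (- w) + e / 4" using a(2) by simp
      moreover have "(?P (a + - w) - ?P a) \<bullet> (- w) \<le> e / 4" by (rule inner_small[OF N(2)[OF a(1) nw] nw])
      ultimately have "- difference_quotient r w \<le> - (p \<bullet> w) + e"
        using e by (simp add: p_def inner_diff_left)
      with up show ?thesis by linarith
    qed
    moreover have "H p = ?k" unfolding p_def using a(1) N(1) by (intro H_maximiser k) auto
    ultimately show "\<exists>p. H p = ?k \<and> (\<forall>w. norm w \<le> 1 \<longrightarrow> \<bar>difference_quotient r w - p \<bullet> w\<bar> \<le> e)" by blast
  qed
qed

lemma linear_blowup_difference_quotient:
  "linear_blowup u x r e \<longleftrightarrow> (\<lambda>k. SUP y\<in>ball 0 1. \<bar>difference_quotient (r k) y - e \<bullet> y\<bar>) \<longlonglongrightarrow> 0"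
  by (simp add: linear_blowup_def difference_quotient_def)

text \<open>Choose scales at which \<open>u\<close> is linear up to \<open>1 / (n + 1)\<close>, and then a subsequence along which the
approximating slopes, all in one compact sublevel set, converge.\<close>

lemma linear_blowup_subsequence:
  assumes r: "\<And>i. 0 < r i" "r \<longlonglongrightarrow> 0"
  shows "\<exists>s e. strict_mono s \<and> linear_blowup u x (r \<circ> s) e"
proof -
  define good where "good e t \<longleftrightarrow>
    (\<exists>p. H p = limit_level \<and> (\<forall>w. norm w \<le> 1 \<longrightarrow> \<bar>difference_quotient t w - p \<bullet> w\<bar> \<le> e))" for e t
  have "\<exists>m. \<forall>i\<ge>m. good (1 / Suc n) (r i)" for n
  proof -
    obtain r0 where "0 < r0" "\<And>t. 0 < t \<Longrightarrow> t < r0 \<Longrightarrow> good (1 / Suc n) t"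
      using nearly_linear_at_small_scales[of "1 / Suc n"] unfolding good_def by auto
    moreover from \<open>0 < r0\<close> r(2) have "\<forall>\<^sub>F i in sequentially. r i < r0"
      by (intro order_tendstoD(2))
    ultimately show ?thesis using r(1) by (auto simp: eventually_sequentially)
  qed
  then obtain m where m: "\<And>n i. m n \<le> i \<Longrightarrow> good (1 / Suc n) (r i)" by metis
  \<comment> \<open>strictly increasing and above m\<close>
  define s where "s n = (\<Sum>i\<le>n. m i + 1)" for n
  have s: "strict_mono s" by (rule strict_monoI_Suc) (simp add: s_def)
  have "m n \<le> s n" for n 
    using member_le_sum[of n "{..n}" "\<lambda>i. m i + 1"] by (simp add: s_def)
  then have "\<forall>n. good (1 / Suc n) (r (s n))" using m by blast
  then obtain p where p: "\<And>n. H (p n) = limit_level"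
      "\<And>n w. norm w \<le> 1 \<Longrightarrow> \<bar>difference_quotient (r (s n)) w - p n \<bullet> w\<bar> \<le> 1 / Suc n"
    unfolding good_def by metis
  have "\<forall>n. p n \<in> sublevel limit_level" by (simp add: sublevel_def p(1))
  then obtain e t where t: "strict_mono t" "(p \<circ> t) \<longlonglongrightarrow> e"
    using compact_sublevel[of limit_level] unfolding compact_def by metis
  have bound: "\<bar>difference_quotient (r (s (t k))) y - e \<bullet> y\<bar> \<le> 1 / Suc (t k) + norm (p (t k) - e)" if "norm y \<le> 1" for k y
  proof -
    have "\<bar>(p (t k) - e) \<bullet> y\<bar> \<le> norm (p (t k) - e) * norm y" by (rule Cauchy_Schwarz_ineq2)
    also have "\<dots> \<le> norm (p (t k) - e) * 1" using that by (rule mult_left_mono) simp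
    finally show ?thesis using p(2)[OF that, of "t k"] by (simp add: inner_diff_left)
  qed
  have "linear_blowup u x (r \<circ> (s \<circ> t)) e"
    unfolding linear_blowup_difference_quotient
  proof (rule real_tendsto_sandwich[OF _ _ tendsto_const])
    let ?f = "\<lambda>k y. \<bar>difference_quotient ((r \<circ> (s \<circ> t)) k) y - e \<bullet> y\<bar>"
    show "\<forall>\<^sub>F k in sequentially. (SUP y\<in>ball 0 1. ?f k y) \<le> 1 / Suc (t k) + norm (p (t k) - e)"
      using bound by (intro always_eventually allI cSUP_least) auto
    have "0 \<le> (SUP y\<in>ball 0 1. ?f k y)" for k
    proof (rule cSUP_upper2[where x="0::'a"])
      show "bdd_above (?f k ` ball 0 1)"
        using bound[of _ k] by (intro bdd_aboveI2[where M="1 / Suc (t k) + norm (p (t k) - e)"]) auto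
    qed auto
    then show "\<forall>\<^sub>F k in sequentially. 0 \<le> (SUP y\<in>ball 0 1. ?f k y)" by simp
    have "(\<lambda>k. 1 / Suc (t k)) \<longlonglongrightarrow> 0"
      using LIMSEQ_subseq_LIMSEQ[OF LIMSEQ_inverse_real_of_nat t(1)] by (simp add: comp_def inverse_eq_divide)
    moreover have "(\<lambda>k. norm (p (t k) - e)) \<longlonglongrightarrow> 0"
      using t(2) by (simp add: comp_def LIM_zero tendsto_norm_zero)
    ultimately show "(\<lambda>k. 1 / Suc (t k) + norm (p (t k) - e)) \<longlonglongrightarrow> 0"
      using tendsto_add by fastforce
  qed
  moreover have "strict_mono (s \<circ> t)" using s t(1) by (rule strict_mono_o)
  ultimately show ?thesis by blast
qed

text \<open>At small scales of the blow-up the slope \<open>e\<close> and some \<open>p\<close> on the level \<open>limit_level\<close> describe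
the same difference quotient up to a small error; hence \<open>e\<close> is a limit of such \<open>p\<close>.\<close>

lemma H_blowup_slope:
  assumes "e \<in> blowup_slopes u x"
  shows "H e = limit_level"
proof -
  obtain r :: "nat \<Rightarrow> real" and s where r: "\<And>i. 0 < r i" "r \<longlonglongrightarrow> 0" and s: "strict_mono s"
    and lb: "linear_blowup u x (r \<circ> s) e"
    using assms by (auto simp: blowup_slopes_def)
  have "\<exists>p. H p = limit_level \<and> dist p e < d" if d: "0 < d" for d
  proof -
    define f where "f = d / 8"
    have f: "0 < f" using d by (simp add: f_def)
    obtain r0 where r0: "0 < r0" "\<And>t. 0 < t \<Longrightarrow> t < r0 \<Longrightarrow>
        \<exists>p. H p = limit_level \<and> (\<forall>w. norm w \<le> 1 \<longrightarrow> \<bar>difference_quotient t w - p \<bullet> w\<bar> \<le> f)"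
      using nearly_linear_at_small_scales[OF f] by auto
    have "\<forall>\<^sub>F k in sequentially. (r \<circ> s) k < r0"
      using LIMSEQ_subseq_LIMSEQ[OF r(2) s] r0(1) by (rule order_tendstoD(2))
    moreover have "\<forall>\<^sub>F k in sequentially. (SUP y\<in>ball 0 1. \<bar>difference_quotient ((r \<circ> s) k) y - e \<bullet> y\<bar>) < f"
      using lb f unfolding linear_blowup_difference_quotient by (rule order_tendstoD(2))
    ultimately obtain k where k: "(r \<circ> s) k < r0" "(SUP y\<in>ball 0 1. \<bar>difference_quotient ((r \<circ> s) k) y - e \<bullet> y\<bar>) < f"
      by (metis (mono_tags, lifting) eventually_conj eventually_happens trivial_limit_sequentially)
    define t where "t = (r \<circ> s) k"
    obtain p where p: "H p = limit_level" "\<And>w. norm w \<le> 1 \<Longrightarrow> \<bar>difference_quotient t w - p \<bullet> w\<bar> \<le> f"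
      using r0(2)[of t] k(1) r(1) by (auto simp: t_def)
    have bdd: "bdd_above ((\<lambda>y. \<bar>difference_quotient t y - e \<bullet> y\<bar>) ` ball 0 1)"
    proof (rule bdd_aboveI2[where M="f + norm (p - e)"])
      fix y :: 'a assume "y \<in> ball 0 1"
      then have y: "norm y \<le> 1" by simp
      have "\<bar>(p - e) \<bullet> y\<bar> \<le> norm (p - e) * norm y" by (rule Cauchy_Schwarz_ineq2)
      also have "\<dots> \<le> norm (p - e) * 1" using y by (rule mult_left_mono) simp
      finally show "\<bar>difference_quotient t y - e \<bullet> y\<bar> \<le> f + norm (p - e)"
        using p(2)[OF y] by (simp add: inner_diff_left)
    qed
    have "dist p e < d"
    proof (cases "p = e")
      case False
      \<comment> \<open>half a unit vector, so that it lies in the open unit ball of the supremum\<close>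
      define w where "w = (1 / (2 * norm (p - e))) *\<^sub>R (p - e)"
      have w: "norm w = 1 / 2" using False by (simp add: w_def)
      have "\<bar>difference_quotient t w - e \<bullet> w\<bar> \<le> (SUP y\<in>ball 0 1. \<bar>difference_quotient t y - e \<bullet> y\<bar>)"
        using w by (intro cSUP_upper bdd) auto
      then have "\<bar>difference_quotient t w - e \<bullet> w\<bar> < f" using k(2) by (simp add: t_def)
      moreover have "\<bar>difference_quotient t w - p \<bullet> w\<bar> \<le> f" using w by (intro p(2)) simp
      ultimately have "(p - e) \<bullet> w \<le> 2 * f" by (simp add: inner_diff_left)
      moreover have "(p - e) \<bullet> w = norm (p - e) / 2"
        using False by (simp add: w_def dot_square_norm power2_eq_square)
      ultimately show ?thesis using d by (simp add: f_def dist_norm)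
    qed (use d in simp)
    with p(1) show ?thesis by blast
  qed
  then have "e \<in> closure {p. H p = limit_level}"
    by (auto simp: closure_approachable)
  moreover have "closed {p. H p = limit_level}"
    by (intro closed_Collect_eq continuous_H continuous_intros)
  ultimately show ?thesis by simp
qed

end

section \<open>Absolute minimizers\<close>

theorem theorem1p1:
  fixes H :: "real ^ 'n \<Rightarrow> real"
  assumes "CARD('n) \<ge> 2"
    and "continuous_on UNIV H"
    and "convex_on UNIV H"
    and "filterlim H at_top at_infinity"
    and "\<And>c a b. a \<noteq> b \<Longrightarrow> \<not> closed_segment a b \<subseteq> H -` {c}"
  shows "\<forall>\<Omega> u. open \<Omega> \<and> connected \<Omega> \<and> \<Omega> \<noteq> {} \<and> u \<in> absolute_minimizers H \<Omega> \<longrightarrow>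
    linear_approximation_property \<Omega> u \<and>
    (\<forall>x\<in>\<Omega>. \<forall>e\<in>blowup_slopes u x.
       ((\<lambda>r. esssup_H H \<Omega> u (ball x r)) \<longlongrightarrow> ereal (H e)) (at_right 0))"
proof (intro allI impI, elim conjE)
  fix \<Omega> u
  assume \<Omega>: "open \<Omega>" and u: "u \<in> absolute_minimizers H \<Omega>"
  interpret segment_free_hamiltonian H
    by unfold_locales (fact assms)+
  have at_point: "\<exists>R. minimizer_at_point H \<Omega> u x R" if "x \<in> \<Omega>" for x
  proof -
    have "\<exists>R>0. cball x R \<subseteq> \<Omega>"
      using \<Omega> that by (simp add: open_contains_cball)
    then obtain R where "0 < R" "cball x R \<subseteq> \<Omega>" by auto
    then have "minimizer_at_point H \<Omega> u x R"
      using \<Omega> u by unfold_locales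
    then show ?thesis ..
  qed
  show "linear_approximation_property \<Omega> u \<and>
    (\<forall>x\<in>\<Omega>. \<forall>e\<in>blowup_slopes u x.
       ((\<lambda>r. esssup_H H \<Omega> u (ball x r)) \<longlongrightarrow> ereal (H e)) (at_right 0))"
    unfolding linear_approximation_property_def
  proof (intro conjI ballI allI impI)
    show "continuous_on \<Omega> u" using u by (simp add: absolute_minimizers_def)
  next
    fix x and r :: "nat \<Rightarrow> real"
    assume x: "x \<in> \<Omega>" and r: "(\<forall>i. 0 < r i) \<and> r \<longlonglongrightarrow> 0"
    obtain R where "minimizer_at_point H \<Omega> u x R" using at_point[OF x] by blast
    then interpret minimizer_at_point H \<Omega> u x R .
    show "\<exists>s e. strict_mono s \<and> linear_blowup u x (r \<circ> s) e"
      using r by (intro linear_blowup_subsequence) auto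
  next
    fix x e assume x: "x \<in> \<Omega>" and e: "e \<in> blowup_slopes u x"
    obtain R where "minimizer_at_point H \<Omega> u x R" using at_point[OF x] by blast
    then interpret minimizer_at_point H \<Omega> u x R .
    show "((\<lambda>r. esssup_H H \<Omega> u (ball x r)) \<longlongrightarrow> ereal (H e)) (at_right 0)"
      unfolding H_blowup_slope[OF e] by (rule energy_tendsto)
  qed
qed

end
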